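(* There exists a class of singular non-Berwaldian Finsler surfaces with $J=0$ and $K=0$; that is, there exist singular Finsler surfaces which are not Berwaldian and whose mean Landsberg curvature $J$ and flag curvature $K$ both vanish identically.
   Context: A singular Finsler surface here means a positive function $F(x,y)$, positively homogeneous of degree one in $y$, defined over a domain $\Omega\subseteq\mathbb{R}^2$, which is smooth with $g_{ij}=\frac12\frac{\partial^2F^2}{\partial y^i\partial y^j}$ positive definite on a nonempty open conic subset of $T\Omega\setminus\{0\}$, but not a smooth strongly convex Finsler metric on all of $T\Omega\setminus\{0\}$ (there are singular tangent directions). All curvature conditions are understood on the conic subset where $F$ is smooth. The spray coefficients are $G^i=\frac14 g^{il}\left(\frac{\partial^2F^2}{\partial x^k\partial y^l}y^k-\frac{\partial F^2}{\partial x^l}\right)$. The Berwald curvature is $B^i_{\ jkl}=\frac{\partial^3G^i}{\partial y^j\partial y^k\partial y^l}$; $F$ is Berwaldian if $B^i_{\ jkl}\equiv0$. The Landsberg curvature is $L_{jkl}=-\frac12F\frac{\partial F}{\partial y^m}B^m_{\ jkl}$ and the mean Landsberg curvature is $J=J_i\,dx^i$ with $J_i=g^{jk}L_{ijk}$. The Riemann curvature is $$R^i_{\ k}=2\frac{\partial G^i}{\partial x^k}-y^j\frac{\partial^2G^i}{\partial x^j\partial y^k}+2G^j\frac{\partial^2G^i}{\partial y^j\partial y^k}-\frac{\partial G^i}{\partial y^j}\frac{\partial G^j}{\partial y^k},$$ and the flag curvature $K$ of a surface is defined by $R^i_{\ k}=K\left(F^2\delta^i_{\ k}-F\frac{\partial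 F}{\partial y^k}y^i\right)$. *)

theory Defs
  imports "HOL-Analysis.Analysis"
begin

primrec Ck_on :: "nat \<Rightarrow> 'a::real_normed_vector set \<Rightarrow> ('a \<Rightarrow> 'b::real_normed_vector) \<Rightarrow> bool" where
  "Ck_on 0 S f \<longleftrightarrow> continuous_on S f"
| "Ck_on (Suc n) S f \<longleftrightarrow>
     (\<forall>p\<in>S. f differentiable (at p)) \<and> (\<forall>v. Ck_on n S (\<lambda>p. frechet_derivative f (at p) v))"

(* Meant for open S: the derivatives are taken in the whole space. *)
definition smooth_on :: "'a::real_normed_vector set \<Rightarrow> ('a \<Rightarrow> 'b::real_normed_vector) \<Rightarrow> bool" where
  "smooth_on S f \<longleftrightarrow> (\<forall>n. Ck_on n S f)"

(* Functions F(x, y) on the tangent bundle of a plane domain are curried: base point x first,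
   tangent vector y second. *)
type_synonym tfun = "real^2 \<Rightarrow> real^2 \<Rightarrow> real"

definition pdx :: "2 \<Rightarrow> tfun \<Rightarrow> tfun" where
  "pdx k f x y = deriv (\<lambda>t. f (x + t *\<^sub>R axis k 1) y) 0"

definition pdy :: "2 \<Rightarrow> tfun \<Rightarrow> tfun" where
  "pdy k f x y = deriv (\<lambda>t. f x (y + t *\<^sub>R axis k 1)) 0"

definition sq :: "tfun \<Rightarrow> tfun" where
  "sq F x y = (F x y)\<^sup>2"

definition fund_tensor :: "tfun \<Rightarrow> real^2 \<Rightarrow> real^2 \<Rightarrow> real^2^2" where
  "fund_tensor F x y = (\<chi> i j. 1/2 * pdy i (pdy j (sq F)) x y)"

definition fund_tensor_inv :: "tfun \<Rightarrow> real^2 \<Rightarrow> real^2 \<Rightarrow> real^2^2" where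
  "fund_tensor_inv F x y = matrix_inv (fund_tensor F x y)"

definition pos_def :: "real^2^2 \<Rightarrow> bool" where
  "pos_def A \<longleftrightarrow> transpose A = A \<and> (\<forall>v. v \<noteq> 0 \<longrightarrow> v \<bullet> (A *v v) > 0)"

definition slit_bundle :: "(real^2) set \<Rightarrow> ((real^2) \<times> (real^2)) set" where
  "slit_bundle \<Omega> = \<Omega> \<times> (- {0})"

(* Differs from the library predicate "conic": scaling acts on the fibre only, by positive factors. *)
definition fibre_conic :: "((real^2) \<times> (real^2)) set \<Rightarrow> bool" where
  "fibre_conic C \<longleftrightarrow> (\<forall>x y c. (x, y) \<in> C \<and> c > 0 \<longrightarrow> (x, c *\<^sub>R y) \<in> C)"

definition strongly_convex_on :: "((real^2) \<times> (real^2)) set \<Rightarrow> tfun \<Rightarrow> bool" where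
  "strongly_convex_on C F \<longleftrightarrow>
     smooth_on C (\<lambda>(x, y). F x y) \<and> (\<forall>(x, y)\<in>C. pos_def (fund_tensor F x y))"

(* The largest open conic subset of the slit tangent bundle on which F is smooth with positive
   definite fundamental tensor; the curvature conditions are imposed on this whole set. *)
definition regular_cone :: "(real^2) set \<Rightarrow> tfun \<Rightarrow> ((real^2) \<times> (real^2)) set" where
  "regular_cone \<Omega> F =
     \<Union> {C. open C \<and> fibre_conic C \<and> C \<subseteq> slit_bundle \<Omega> \<and> strongly_convex_on C F}"

definition singular_finsler_surface :: "(real^2) set \<Rightarrow> tfun \<Rightarrow> bool" where
  "singular_finsler_surface \<Omega> F \<longleftrightarrow>
     open \<Omega> \<and> connected \<Omega> \<and> \<Omega> \<noteq> {} \<and>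
     (\<forall>x\<in>\<Omega>. \<forall>y. y \<noteq> 0 \<longrightarrow> F x y > 0) \<and>
     (\<forall>x\<in>\<Omega>. \<forall>y. \<forall>c>0. F x (c *\<^sub>R y) = c * F x y) \<and>
     regular_cone \<Omega> F \<noteq> {} \<and>
     \<not> strongly_convex_on (slit_bundle \<Omega>) F"

(* In the tensors below the index arguments follow the order i, j, k, l of the components,
   upper index first. *)

definition spray :: "tfun \<Rightarrow> 2 \<Rightarrow> tfun" where
  "spray F i x y = 1/4 * (\<Sum>l\<in>UNIV. fund_tensor_inv F x y $ i $ l *
     ((\<Sum>k\<in>UNIV. pdx k (pdy l (sq F)) x y * y $ k) - pdx l (sq F) x y))"

definition berwald_curv :: "tfun \<Rightarrow> 2 \<Rightarrow> 2 \<Rightarrow> 2 \<Rightarrow> 2 \<Rightarrow> tfun" where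
  "berwald_curv F i j k l = pdy j (pdy k (pdy l (spray F i)))"

definition berwaldian :: "(real^2) set \<Rightarrow> tfun \<Rightarrow> bool" where
  "berwaldian \<Omega> F \<longleftrightarrow>
     (\<forall>(x, y)\<in>regular_cone \<Omega> F. \<forall>i j k l. berwald_curv F i j k l x y = 0)"

definition landsberg_curv :: "tfun \<Rightarrow> 2 \<Rightarrow> 2 \<Rightarrow> 2 \<Rightarrow> tfun" where
  "landsberg_curv F j k l x y =
     - 1/2 * F x y * (\<Sum>m\<in>UNIV. pdy m F x y * berwald_curv F m j k l x y)"

definition mean_landsberg_curv :: "tfun \<Rightarrow> 2 \<Rightarrow> tfun" where
  "mean_landsberg_curv F i x y =
     (\<Sum>j\<in>UNIV. \<Sum>k\<in>UNIV. fund_tensor_inv F x y $ j $ k * landsberg_curv F i j k x y)"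

definition riemann_curv :: "tfun \<Rightarrow> 2 \<Rightarrow> 2 \<Rightarrow> tfun" where
  "riemann_curv F i k x y =
     2 * pdx k (spray F i) x y
     - (\<Sum>j\<in>UNIV. y $ j * pdx j (pdy k (spray F i)) x y)
     + 2 * (\<Sum>j\<in>UNIV. spray F j x y * pdy j (pdy k (spray F i)) x y)
     - (\<Sum>j\<in>UNIV. pdy j (spray F i) x y * pdy k (spray F j) x y)"

(* F x y > 0 makes the trace F^2 of the right-hand factor nonzero, so K is unique on the
   regular cone. *)
definition has_flag_curvature :: "(real^2) set \<Rightarrow> tfun \<Rightarrow> tfun \<Rightarrow> bool" where
  "has_flag_curvature \<Omega> F K \<longleftrightarrow>
     (\<forall>(x, y)\<in>regular_cone \<Omega> F. \<forall>i k.
        riemann_curv F i k x y =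
          K x y * ((F x y)\<^sup>2 * (if i = k then 1 else 0) - F x y * pdy k F x y * y $ i))"

lemma Ck_on_Union:
  assumes "\<And>S. S \<in> \<S> \<Longrightarrow> open S" "\<And>S. S \<in> \<S> \<Longrightarrow> Ck_on n S f"
  shows "Ck_on n (\<Union>\<S>) f"
  using assms(2)
proof (induction n arbitrary: f)
  case 0
  then show ?case using assms(1) by (auto intro: continuous_on_open_Union)
next
  case (Suc n)
  then show ?case by auto
qed

lemma regular_cone_largest:
  shows "open (regular_cone \<Omega> F)" "fibre_conic (regular_cone \<Omega> F)"
    "regular_cone \<Omega> F \<subseteq> slit_bundle \<Omega>" "strongly_convex_on (regular_cone \<Omega> F) F"
    "\<lbrakk>open C; fibre_conic C; C \<subseteq> slit_bundle \<Omega>; strongly_convex_on C F\<rbrakk>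
       \<Longrightarrow> C \<subseteq> regular_cone \<Omega> F"
proof -
  show "open (regular_cone \<Omega> F)" by (auto simp: regular_cone_def)
  show "fibre_conic (regular_cone \<Omega> F)" unfolding regular_cone_def fibre_conic_def by blast
  show "regular_cone \<Omega> F \<subseteq> slit_bundle \<Omega>" by (auto simp: regular_cone_def)
  have "smooth_on (regular_cone \<Omega> F) (\<lambda>(x, y). F x y)"
    unfolding smooth_on_def regular_cone_def
    by (intro allI Ck_on_Union) (auto simp: strongly_convex_on_def smooth_on_def)
  then show "strongly_convex_on (regular_cone \<Omega> F) F"
    unfolding strongly_convex_on_def by (auto simp: regular_cone_def strongly_convex_on_def)
qed (auto simp: regular_cone_def)

end

theory Submission imports Defs begin

text \<open>
  The surface is explicit. Write \<open>a\<close>, \<open>c\<close> for the coordinates of a base point in the open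
  quadrant \<open>a > 0\<close>, \<open>c > 0\<close>. For a vector \<open>y\<close> with \<open>y\<^sub>1 > 0\<close> let \<open>s > 0\<close> be the number with
  \<open>y\<^sub>2 / y\<^sub>1 = 3 a / s + c / (2 s\<^sup>2) - s\<close>; the right-hand side decreases from infinity to minus
  infinity, so \<open>s\<close> exists and is unique. On this half of each tangent plane the metric is
  \<open>F = y\<^sub>1 (s\<^sup>3 + 3 a s + c)\<^sup>2 / (s\<^sup>2 (s\<^sup>2 + a)\<^bsup>2/3\<^esup>)\<close>, on the other half it is \<open>\<bar>y\<^sub>2\<bar> - y\<^sub>1\<close>, whose
  square has a degenerate Hessian wherever \<open>y\<^sub>2\<close> is not zero.

  The formula comes from Cartan's structure equations. Let \<open>\<omega>\<^sub>1\<close>, \<open>\<omega>\<^sub>2\<close>, \<open>\<omega>\<^sub>3\<close> be the canonical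
  coframe of the unit circle bundle. If \<open>K = 0\<close> and \<open>J = 0\<close> then \<open>\<omega>\<^sub>3\<close> is closed, locally
  \<open>\<omega>\<^sub>3 = d\<theta>\<close>, and \<open>\<omega>\<^sub>1\<close>, \<open>\<omega>\<^sub>2\<close> restrict to closed forms on the leaves of constant \<open>\<theta>\<close>. Integration
  gives \<open>\<omega>\<^sub>1 = du - v d\<theta>\<close> and \<open>\<omega>\<^sub>2 = dv + (u - H(v, \<theta>)) d\<theta>\<close> with a free function \<open>H\<close>. The points
  of the surface are the solutions of \<open>u'' + u = H(u', \<theta>)\<close>, and the surface is Berwaldian only
  if \<open>H\<close> is affine in its first argument. For suitable \<open>H\<close> built from the square root of \<open>v\<close>
  the equation reduces to a Bernoulli equation with solutions that are algebraic in
  \<open>\<tau> = s\<^sup>2 + a\<close>, up to fractional powers of \<open>\<tau>\<close>, where \<open>\<theta>\<close> is a multiple of the logarithm of \<open>\<tau>\<close>. The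
  integration constants \<open>a\<close> and \<open>c\<close> are the coordinates, and the equation for \<open>s\<close> expresses that
  \<open>\<omega>\<^sub>2\<close> vanishes on \<open>y\<close>.

  The proof verifies the outcome directly. A function that is homogeneous on the half-planes
  is a power of \<open>y\<^sub>1\<close> times a function of the base point and the slope \<open>t = y\<^sub>2 / y\<^sub>1\<close>, and all
  partial derivatives preserve this shape. So the assertions about \<open>F = y\<^sub>1 n(x, t)\<close> and spray
  coefficients \<open>y\<^sub>1\<^sup>2 h(x, t)\<close>, \<open>y\<^sub>1\<^sup>2 k(x, t)\<close> become five differential equations for \<open>n\<close>, \<open>h\<close>
  and \<open>k\<close> (the locale \<open>half_plane_surface\<close>). Here \<open>h\<close> and \<open>k\<close> are rational in \<open>a\<close>, \<open>c\<close>, \<open>s\<close>,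
  while \<open>n\<close> is rational up to one fractional power, so that implicit differentiation of \<open>s\<close>
  reduces the five equations to rational identities. The third slope derivative of \<open>h\<close> is a
  Berwald curvature component and does not vanish identically, so the surface is not Berwaldian.
\<close>

section \<open>Functions homogeneous on the half-planes of positive first component\<close>

text \<open>
  The second argument of \<open>h\<close> is the slope \<open>y\<^sub>2 / y\<^sub>1\<close>. The degree is an integer because the
  third vertical derivatives of a spray have degree \<open>- 1\<close>.
\<close>

definition is_fibre_hom ::
  "(real^2) set \<Rightarrow> tfun \<Rightarrow> int \<Rightarrow> (real^2 \<Rightarrow> real \<Rightarrow> real) \<Rightarrow> bool" where
  "is_fibre_hom \<Omega> f m h \<longleftrightarrow>
     (\<forall>x\<in>\<Omega>. \<forall>y. y$1 > 0 \<longrightarrow> f x y = (y$1) powi m * h x (y$2 / y$1))"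

definition x_partials ::
  "(real^2) set \<Rightarrow> (real^2 \<Rightarrow> real \<Rightarrow> real) \<Rightarrow> (2 \<Rightarrow> real^2 \<Rightarrow> real \<Rightarrow> real) \<Rightarrow> bool" where
  "x_partials \<Omega> h h' \<longleftrightarrow>
     (\<forall>x\<in>\<Omega>. \<forall>t k. ((\<lambda>r. h (x + r *\<^sub>R axis k 1) t) has_real_derivative h' k x t) (at 0))"

definition t_partial ::
  "(real^2) set \<Rightarrow> (real^2 \<Rightarrow> real \<Rightarrow> real) \<Rightarrow> (real^2 \<Rightarrow> real \<Rightarrow> real) \<Rightarrow> bool" where
  "t_partial \<Omega> h h' \<longleftrightarrow> (\<forall>x\<in>\<Omega>. \<forall>t. (h x has_real_derivative h' x t) (at t))"

lemma is_fibre_homD: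
  "\<lbrakk>is_fibre_hom \<Omega> f m h; x \<in> \<Omega>; y$1 > 0\<rbrakk> \<Longrightarrow> f x y = (y$1) powi m * h x (y$2 / y$1)"
  by (auto simp: is_fibre_hom_def)

lemma t_partial_compose:
  assumes "t_partial \<Omega> h h'" "x \<in> \<Omega>" "(g has_real_derivative d) (at r)"
  shows "((\<lambda>r. h x (g r)) has_real_derivative h' x (g r) * d) (at r)"
proof -
  have "(h x has_real_derivative h' x (g r)) (at (g r))"
    using assms by (auto simp: t_partial_def)
  from DERIV_chain2[OF this assms(3)] show ?thesis .
qed

text \<open>
  The slope does not involve the base point, so horizontal derivatives act on the coefficient
  alone.
\<close>

lemma is_fibre_hom_pdx:
  assumes \<Omega>: "open \<Omega>" and f: "is_fibre_hom \<Omega> f m h" and h: "x_partials \<Omega> h h'"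
  shows "is_fibre_hom \<Omega> (pdx k f) m (h' k)"
  unfolding is_fibre_hom_def
proof (intro ballI allI impI)
  fix x y :: "real^2" assume x: "x \<in> \<Omega>" and y: "y$1 > 0"
  let ?S = "(\<lambda>r. x + r *\<^sub>R axis k 1) -` \<Omega>"
  have S: "open ?S" by (intro open_vimage \<Omega> continuous_intros)
  have "((\<lambda>r. h (x + r *\<^sub>R axis k 1) (y$2 / y$1)) has_real_derivative h' k x (y$2 / y$1)) (at 0)"
    using h x by (auto simp: x_partials_def)
  then have "((\<lambda>r. (y$1) powi m * h (x + r *\<^sub>R axis k 1) (y$2 / y$1)) has_real_derivative
      (y$1) powi m * h' k x (y$2 / y$1)) (at 0)"
    by (rule DERIV_cmult)
  then have "((\<lambda>r. f (x + r *\<^sub>R axis k 1) y) has_real_derivative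
      (y$1) powi m * h' k x (y$2 / y$1)) (at 0)"
    by (rule has_field_derivative_transform_within_open[OF _ S])
       (use x is_fibre_homD[OF f _ y] in auto)
  then show "pdx k f x y = (y$1) powi m * h' k x (y$2 / y$1)"
    unfolding pdx_def by (rule DERIV_imp_deriv)
qed

text \<open>
  The slope has derivative \<open>1 / y\<^sub>1\<close> in direction \<open>y\<^sub>2\<close> and \<open>- t / y\<^sub>1\<close> in direction \<open>y\<^sub>1\<close>; the
  remaining term comes from the power of \<open>y\<^sub>1\<close>.
\<close>

lemma is_fibre_hom_pdy:
  assumes f: "is_fibre_hom \<Omega> f m h" and h: "t_partial \<Omega> h h'"
  shows "is_fibre_hom \<Omega> (pdy 1 f) (m - 1) (\<lambda>x t. of_int m * h x t - t * h' x t)"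
    and "is_fibre_hom \<Omega> (pdy 2 f) (m - 1) h'"
proof -
  have powi: "(r::real) powi m = r * r powi (m - 1)" if "r > 0" for r
    using that power_int_minus_mult[of r m] by (simp add: mult.commute)
  show "is_fibre_hom \<Omega> (pdy 1 f) (m - 1) (\<lambda>x t. of_int m * h x t - t * h' x t)"
    unfolding is_fibre_hom_def
  proof (intro ballI allI impI)
    fix x y :: "real^2" assume x: "x \<in> \<Omega>" and y: "y$1 > 0"
    let ?d = "(y$1) powi (m - 1) * (of_int m * h x (y$2 / y$1) - y$2 / y$1 * h' x (y$2 / y$1))"
    have q: "((\<lambda>r. y$2 / (y$1 + r)) has_real_derivative - y$2 / (y$1)\<^sup>2) (at 0)"
      using y by (auto intro!: derivative_eq_intros simp: power2_eq_square)
    have p: "((\<lambda>r. (y$1 + r) powi m) has_real_derivative of_int m * (y$1) powi (m - 1)) (at 0)"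
      using y by (auto intro!: derivative_eq_intros)
    have "((\<lambda>r. (y$1 + r) powi m * h x (y$2 / (y$1 + r))) has_real_derivative ?d) (at 0)"
      by (rule DERIV_cong[OF DERIV_mult[OF p t_partial_compose[OF h x q]]])
         (use y powi[OF y] in \<open>simp add: field_simps power2_eq_square\<close>)
    then have "((\<lambda>r. f x (y + r *\<^sub>R axis 1 1)) has_real_derivative ?d) (at 0)"
      by (rule has_field_derivative_transform_within_open[where S = "{- y$1<..}"])
         (use x y is_fibre_homD[OF f x] in \<open>auto simp: axis_def\<close>)
    then show "pdy 1 f x y = ?d"
      unfolding pdy_def by (rule DERIV_imp_deriv)
  qed
  show "is_fibre_hom \<Omega> (pdy 2 f) (m - 1) h'"
    unfolding is_fibre_hom_def
  proof (intro ballI allI impI)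
    fix x y :: "real^2" assume x: "x \<in> \<Omega>" and y: "y$1 > 0"
    let ?d = "(y$1) powi (m - 1) * h' x (y$2 / y$1)"
    have q: "((\<lambda>r. (y$2 + r) / y$1) has_real_derivative 1 / y$1) (at 0)"
      using y by (auto intro!: derivative_eq_intros)
    have "((\<lambda>r. (y$1) powi m * h x ((y$2 + r) / y$1)) has_real_derivative ?d) (at 0)"
      by (rule DERIV_cong[OF DERIV_cmult[OF t_partial_compose[OF h x q]]])
         (use y powi[OF y] in \<open>simp add: field_simps\<close>)
    moreover have "f x (y + r *\<^sub>R axis 2 1) = (y$1) powi m * h x ((y$2 + r) / y$1)" for r
      using is_fibre_homD[OF f x, of "y + r *\<^sub>R axis 2 1"] y by (simp add: axis_def)
    ultimately have "((\<lambda>r. f x (y + r *\<^sub>R axis 2 1)) has_real_derivative ?d) (at 0)"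
      by simp
    then show "pdy 2 f x y = ?d"
      unfolding pdy_def by (rule DERIV_imp_deriv)
  qed
qed

text \<open>
  The third derivatives have degree \<open>- 1\<close> and the second ones degree \<open>0\<close>, so by Euler's
  identity each index \<open>1\<close> in place of an index \<open>2\<close> costs a factor \<open>- t\<close>.
\<close>

lemma third_pdy_of_quadratic:
  assumes f: "is_fibre_hom \<Omega> f 2 h"
    and h: "t_partial \<Omega> h h1" "t_partial \<Omega> h1 h2" "t_partial \<Omega> h2 h3"
  shows "is_fibre_hom \<Omega> (pdy i (pdy j (pdy k f))) (-1)
    (\<lambda>x t. (if i = 1 then - t else 1) * (if j = 1 then - t else 1) * (if k = 1 then - t else 1)
       * h3 x t)"
proof -
  have d: "t_partial \<Omega> (\<lambda>x t. 2 * h x t - t * h1 x t) (\<lambda>x t. h1 x t - t * h2 x t)"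
    "t_partial \<Omega> (\<lambda>x t. h1 x t - t * h2 x t) (\<lambda>x t. - t * h3 x t)"
    "t_partial \<Omega> (\<lambda>x t. (2 * h x t - t * h1 x t) - t * (h1 x t - t * h2 x t))
       (\<lambda>x t. t\<^sup>2 * h3 x t)"
    using h unfolding t_partial_def
    by (auto intro!: derivative_eq_intros simp: algebra_simps power2_eq_square)
  note first = is_fibre_hom_pdy[OF f h(1), simplified]
  note second = is_fibre_hom_pdy[OF first(1) d(1), simplified]
    is_fibre_hom_pdy[OF first(2) h(2), simplified]
  note third = is_fibre_hom_pdy[OF second(1) d(3), simplified]
    is_fibre_hom_pdy[OF second(2) d(2), simplified]
    is_fibre_hom_pdy[OF second(3) d(2), simplified]
    is_fibre_hom_pdy[OF second(4) h(3), simplified]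
  have "i = 1 \<or> i = 2" "j = 1 \<or> j = 2" "k = 1 \<or> k = 2"
    using exhaust_2 by auto
  then show ?thesis
    using third by (elim disjE) (simp_all add: power2_eq_square mult.assoc)
qed

section \<open>Spray and curvature in terms of the slope\<close>

text \<open>
  The functions \<open>h\<close> and \<open>k\<close> are the candidate spray coefficients; digits count slope
  derivatives and the suffix \<open>x\<close> marks derivatives in the base point. The geodesic equations
  say that the spray annihilates \<open>F\<close> and that the second component of the Euler--Lagrange
  equation of \<open>F\<close> holds along it; the Landsberg equation is the contraction of \<open>\<partial>F/\<partial>y\<^sup>m\<close> with
  the Berwald curvature, up to a factor; the flatness equations are the components \<open>R\<^sup>1\<^sub>2\<close> and \<open>R\<^sup>2\<^sub>2\<close> divided by \<open>y\<^sub>1\<^sup>2\<close>. The components \<open>R\<^sup>i\<^sub>1\<close> need no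
  further equation since \<open>R\<^sup>i\<^sub>j y\<^sup>j = 0\<close>.
\<close>

locale half_plane_surface =
  fixes \<Omega> :: "(real^2) set" and F :: tfun
    and n n1 n2 h h1 h2 h3 k k1 k2 k3 :: "real^2 \<Rightarrow> real \<Rightarrow> real"
    and nx n1x hx h1x kx k1x :: "2 \<Rightarrow> real^2 \<Rightarrow> real \<Rightarrow> real"
  assumes open_base: "open \<Omega>"
    and metric: "is_fibre_hom \<Omega> F 1 n"
    and n_t: "t_partial \<Omega> n n1" "t_partial \<Omega> n1 n2"
    and n_x: "x_partials \<Omega> n nx" "x_partials \<Omega> n1 n1x"
    and h_t: "t_partial \<Omega> h h1" "t_partial \<Omega> h1 h2" "t_partial \<Omega> h2 h3"
    and h_x: "x_partials \<Omega> h hx" "x_partials \<Omega> h1 h1x"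
    and k_t: "t_partial \<Omega> k k1" "t_partial \<Omega> k1 k2" "t_partial \<Omega> k2 k3"
    and k_x: "x_partials \<Omega> k kx" "x_partials \<Omega> k1 k1x"
    and n_pos: "\<And>x t. x \<in> \<Omega> \<Longrightarrow> n x t > 0" "\<And>x t. x \<in> \<Omega> \<Longrightarrow> n2 x t > 0"
    and geodesic_eqs:
      "\<And>x t. x \<in> \<Omega> \<Longrightarrow>
        nx 1 x t + t * nx 2 x t = 2 * ((n x t - t * n1 x t) * h x t + n1 x t * k x t)"
      "\<And>x t. x \<in> \<Omega> \<Longrightarrow>
        n1x 1 x t + t * n1x 2 x t - nx 2 x t = 2 * n2 x t * (k x t - t * h x t)"
    and landsberg_eq:
      "\<And>x t. x \<in> \<Omega> \<Longrightarrow> (n x t - t * n1 x t) * h3 x t + n1 x t * k3 x t = 0"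
    and flat_eqs:
      "\<And>x t. x \<in> \<Omega> \<Longrightarrow> 2 * hx 2 x t - h1x 1 x t - t * h1x 2 x t
         + 2 * (k x t - t * h x t) * h2 x t + t * (h1 x t)\<^sup>2 - h1 x t * k1 x t = 0"
      "\<And>x t. x \<in> \<Omega> \<Longrightarrow> 2 * kx 2 x t - k1x 1 x t - t * k1x 2 x t
         + 2 * (h x t * (k1 x t - t * k2 x t) + k x t * k2 x t)
         - ((2 * k x t - t * k1 x t) * h1 x t + (k1 x t)\<^sup>2) = 0"
begin

lemma metric_pdy:
  "is_fibre_hom \<Omega> (pdy 1 F) 0 (\<lambda>x t. n x t - t * n1 x t)"
  "is_fibre_hom \<Omega> (pdy 2 F) 0 n1"
  using is_fibre_hom_pdy[OF metric n_t(1)] by auto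

lemma sq_metric: "is_fibre_hom \<Omega> (sq F) 2 (\<lambda>x t. (n x t)\<^sup>2)"
  using metric by (auto simp: is_fibre_hom_def sq_def power_mult_distrib)

lemma sq_metric_pdy:
  "is_fibre_hom \<Omega> (pdy 1 (sq F)) 1 (\<lambda>x t. 2 * n x t * (n x t - t * n1 x t))"
  "is_fibre_hom \<Omega> (pdy 2 (sq F)) 1 (\<lambda>x t. 2 * n x t * n1 x t)"
proof -
  have "t_partial \<Omega> (\<lambda>x t. (n x t)\<^sup>2) (\<lambda>x t. 2 * n x t * n1 x t)"
    using n_t unfolding t_partial_def by (auto intro!: derivative_eq_intros)
  from is_fibre_hom_pdy[OF sq_metric this]
  show "is_fibre_hom \<Omega> (pdy 1 (sq F)) 1 (\<lambda>x t. 2 * n x t * (n x t - t * n1 x t))"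
    "is_fibre_hom \<Omega> (pdy 2 (sq F)) 1 (\<lambda>x t. 2 * n x t * n1 x t)"
    by (auto simp: algebra_simps power2_eq_square)
qed

lemma fund_tensor_entries:
  assumes x: "x \<in> \<Omega>" and y: "y$1 > 0" and t: "t = y$2 / y$1"
  shows "fund_tensor F x y $ 1 $ 1 = (n x t - t * n1 x t)\<^sup>2 + n x t * t\<^sup>2 * n2 x t"
    and "fund_tensor F x y $ 1 $ 2 = (n x t - t * n1 x t) * n1 x t - n x t * t * n2 x t"
    and "fund_tensor F x y $ 2 $ 1 = (n x t - t * n1 x t) * n1 x t - n x t * t * n2 x t"
    and "fund_tensor F x y $ 2 $ 2 = (n1 x t)\<^sup>2 + n x t * n2 x t"
proof -
  have "t_partial \<Omega> (\<lambda>x t. 2 * n x t * (n x t - t * n1 x t))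
      (\<lambda>x t. 2 * (n1 x t * (n x t - t * n1 x t) - n x t * t * n2 x t))"
    and "t_partial \<Omega> (\<lambda>x t. 2 * n x t * n1 x t) (\<lambda>x t. 2 * ((n1 x t)\<^sup>2 + n x t * n2 x t))"
    using n_t unfolding t_partial_def
    by (auto intro!: derivative_eq_intros simp: algebra_simps power2_eq_square)
  from is_fibre_hom_pdy[OF sq_metric_pdy(1) this(1)] is_fibre_hom_pdy[OF sq_metric_pdy(2) this(2)]
  show "fund_tensor F x y $ 1 $ 1 = (n x t - t * n1 x t)\<^sup>2 + n x t * t\<^sup>2 * n2 x t"
    and "fund_tensor F x y $ 1 $ 2 = (n x t - t * n1 x t) * n1 x t - n x t * t * n2 x t"
    and "fund_tensor F x y $ 2 $ 1 = (n x t - t * n1 x t) * n1 x t - n x t * t * n2 x t"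
    and "fund_tensor F x y $ 2 $ 2 = (n1 x t)\<^sup>2 + n x t * n2 x t"
    unfolding fund_tensor_def t
    by (auto dest!: is_fibre_homD[OF _ x y] simp: algebra_simps power2_eq_square)
qed

text \<open>
  The quadratic form splits as \<open>(\<partial>F(v))\<^sup>2 + n n\<^sub>2 (v\<^sub>2 - t v\<^sub>1)\<^sup>2\<close>. The second square vanishes only
  for multiples of \<open>y\<close>, and on these the first one is positive by homogeneity of \<open>F\<close>.
\<close>

lemma pos_def_fund_tensor:
  assumes x: "x \<in> \<Omega>" and y: "y$1 > 0"
  shows "pos_def (fund_tensor F x y)"
proof -
  define t where "t = y$2 / y$1"
  note entries = fund_tensor_entries[OF x y t_def]
  have "v \<bullet> (fund_tensor F x y *v v) > 0" if "v \<noteq> 0" for v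
  proof -
    have "v \<bullet> (fund_tensor F x y *v v) =
        ((n x t - t * n1 x t) * v$1 + n1 x t * v$2)\<^sup>2 + n x t * n2 x t * (v$2 - t * v$1)\<^sup>2"
      by (simp add: inner_vec_def matrix_vector_mult_def sum_2 entries)
         (simp add: algebra_simps power2_eq_square)
    also have "\<dots> > 0"
    proof (cases "v$2 = t * v$1")
      case True
      then have "v$1 \<noteq> 0" using that by (auto simp: vec_eq_iff forall_2)
      moreover have "(n x t - t * n1 x t) * v$1 + n1 x t * v$2 = n x t * v$1"
        by (simp add: True algebra_simps)
      ultimately show ?thesis using n_pos[OF x, of t] by (simp add: True)
    next
      case False
      then show ?thesis using n_pos[OF x, of t] by (intro add_nonneg_pos) auto
    qed
    finally show ?thesis .
  qed
  then show ?thesis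
    by (auto simp: pos_def_def vec_eq_iff forall_2 transpose_def entries)
qed

lemma fund_tensor_inv_mult:
  assumes x: "x \<in> \<Omega>" and y: "y$1 > 0"
  shows "fund_tensor_inv F x y *v (fund_tensor F x y *v v) = v"
proof -
  have "\<forall>v. fund_tensor F x y *v v = 0 \<longrightarrow> v = 0"
    using pos_def_fund_tensor[OF x y] unfolding pos_def_def by (metis inner_zero_right less_irrefl)
  then have "invertible (fund_tensor F x y)"
    using matrix_left_invertible_ker invertible_left_inverse by blast
  then show ?thesis
    unfolding fund_tensor_inv_def matrix_inv_def invertible_def
    by (metis (mono_tags, lifting) matrix_vector_mul_assoc matrix_vector_mul_lid someI_ex)
qed

text \<open>
  The geodesic equations say that the covector in the definition of the spray is \<open>4 g G\<close> for
  \<open>G = y\<^sub>1\<^sup>2 (h, k)\<close>; the inverse of \<open>g\<close> cancels, so it never has to be computed.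
\<close>

lemma spray_fibre_hom:
  "is_fibre_hom \<Omega> (spray F 1) 2 h" "is_fibre_hom \<Omega> (spray F 2) 2 k"
proof -
  have "spray F 1 x y = (y$1)\<^sup>2 * h x (y$2 / y$1) \<and> spray F 2 x y = (y$1)\<^sup>2 * k x (y$2 / y$1)"
    if x: "x \<in> \<Omega>" and y: "y$1 > 0" for x y
  proof -
    define t where "t = y$2 / y$1"
    define G :: "real^2" where "G = (\<chi> i. (y$1)\<^sup>2 * (if i = 1 then h x t else k x t))"
    define V :: "real^2" where
      "V = (\<chi> l. (\<Sum>j\<in>UNIV. pdx j (pdy l (sq F)) x y * y$j) - pdx l (sq F) x y)"
    have y2: "y$2 = t * y$1" using y by (simp add: t_def)
    have "x_partials \<Omega> (\<lambda>x t. (n x t)\<^sup>2) (\<lambda>i x t. 2 * n x t * nx i x t)"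
      "x_partials \<Omega> (\<lambda>x t. 2 * n x t * (n x t - t * n1 x t))
         (\<lambda>i x t. 2 * (nx i x t * (n x t - t * n1 x t) + n x t * (nx i x t - t * n1x i x t)))"
      "x_partials \<Omega> (\<lambda>x t. 2 * n x t * n1 x t)
         (\<lambda>i x t. 2 * (nx i x t * n1 x t + n x t * n1x i x t))"
      using n_x unfolding x_partials_def
      by (auto intro!: derivative_eq_intros simp: algebra_simps power2_eq_square)
    note D = this
    note E = is_fibre_homD[OF is_fibre_hom_pdx[OF open_base sq_metric D(1)] x y, folded t_def]
      is_fibre_homD[OF is_fibre_hom_pdx[OF open_base sq_metric_pdy(1) D(2)] x y, folded t_def]
      is_fibre_homD[OF is_fibre_hom_pdx[OF open_base sq_metric_pdy(2) D(3)] x y, folded t_def]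
    note g = fund_tensor_entries[OF x y t_def]
    have "V = 4 *\<^sub>R (fund_tensor F x y *v G)"
    proof -
      have "V$1 = 4 * (fund_tensor F x y *v G)$1"
        using geodesic_eqs[OF x, of t]
        by (simp add: V_def G_def matrix_vector_mult_def sum_2 E g y2) algebra
      moreover have "V$2 = 4 * (fund_tensor F x y *v G)$2"
        using geodesic_eqs[OF x, of t]
        by (simp add: V_def G_def matrix_vector_mult_def sum_2 E g y2) algebra
      ultimately show ?thesis by (simp add: vec_eq_iff forall_2)
    qed
    then have "(1/4) *\<^sub>R (fund_tensor_inv F x y *v V) = G"
      using fund_tensor_inv_mult[OF x y, of G] by (simp add: matrix_vector_mult_scaleR)
    then have "spray F i x y = G$i" for i
      by (auto simp: spray_def V_def matrix_vector_mult_def vec_eq_iff)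
    then show ?thesis by (simp add: G_def t_def)
  qed
  then show "is_fibre_hom \<Omega> (spray F 1) 2 h" "is_fibre_hom \<Omega> (spray F 2) 2 k"
    by (auto simp: is_fibre_hom_def)
qed

lemma berwald_curv_eq:
  assumes x: "x \<in> \<Omega>" and y: "y$1 > 0"
  shows "berwald_curv F i j l m x y =
    (if j = 1 then - (y$2 / y$1) else 1) * (if l = 1 then - (y$2 / y$1) else 1)
    * (if m = 1 then - (y$2 / y$1) else 1)
    * (if i = 1 then h3 x (y$2 / y$1) else k3 x (y$2 / y$1)) / y$1"
  using exhaust_2[of i]
    is_fibre_homD[OF third_pdy_of_quadratic[OF spray_fibre_hom(1) h_t] x y, of j l m]
    is_fibre_homD[OF third_pdy_of_quadratic[OF spray_fibre_hom(2) k_t] x y, of j l m]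
  by (auto simp: berwald_curv_def power_int_minus field_simps)

text \<open>
  All components of the Berwald curvature are multiples of \<open>h\<^sub>3\<close> and \<open>k\<^sub>3\<close> with a factor that
  depends on the lower indices only, so one equation makes all of them orthogonal to \<open>\<partial>F/\<partial>y\<^sup>m\<close>.
\<close>

lemma landsberg_curv_zero:
  assumes x: "x \<in> \<Omega>" and y: "y$1 > 0"
  shows "landsberg_curv F i j l x y = 0"
proof -
  let ?t = "y$2 / y$1"
  let ?s = "(if i = 1 then - ?t else 1) * (if j = 1 then - ?t else 1)
    * (if l = 1 then - ?t else 1) / y$1"
  have "pdy 1 F x y = n x ?t - ?t * n1 x ?t" "pdy 2 F x y = n1 x ?t"
    using metric_pdy[THEN is_fibre_homD, OF x y] by simp_all
  then have "(\<Sum>m\<in>UNIV. pdy m F x y * berwald_curv F m i j l x y)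
      = ?s * ((n x ?t - ?t * n1 x ?t) * h3 x ?t + n1 x ?t * k3 x ?t)"
    by (simp only: sum_2 berwald_curv_eq[OF x y] if_True)
       (simp add: distrib_left mult_ac)
  also have "\<dots> = 0" using landsberg_eq[OF x, of ?t] by (simp only: mult_zero_right)
  finally have "(\<Sum>m\<in>UNIV. pdy m F x y * berwald_curv F m i j l x y) = 0" .
  then show ?thesis by (simp add: landsberg_curv_def)
qed

lemma mean_landsberg_curv_zero:
  assumes "x \<in> \<Omega>" "y$1 > 0"
  shows "mean_landsberg_curv F i x y = 0"
  by (simp add: mean_landsberg_curv_def landsberg_curv_zero[OF assms])

lemma riemann_curv_zero:
  assumes x: "x \<in> \<Omega>" and y: "y$1 > 0"
  shows "riemann_curv F i j x y = 0"
proof -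
  define t where "t = y$2 / y$1"
  have y2: "y$2 = t * y$1" using y by (simp add: t_def)
  have Dt: "t_partial \<Omega> (\<lambda>x t. 2 * h x t - t * h1 x t) (\<lambda>x t. h1 x t - t * h2 x t)"
    "t_partial \<Omega> (\<lambda>x t. 2 * k x t - t * k1 x t) (\<lambda>x t. k1 x t - t * k2 x t)"
    using h_t k_t unfolding t_partial_def
    by (auto intro!: derivative_eq_intros simp: algebra_simps power2_eq_square)
  have Dx: "x_partials \<Omega> (\<lambda>x t. 2 * h x t - t * h1 x t) (\<lambda>i x t. 2 * hx i x t - t * h1x i x t)"
    "x_partials \<Omega> (\<lambda>x t. 2 * k x t - t * k1 x t) (\<lambda>i x t. 2 * kx i x t - t * k1x i x t)"
    using h_x k_x unfolding x_partials_def
    by (auto intro!: derivative_eq_intros simp: algebra_simps power2_eq_square)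
  note N = is_fibre_hom_pdy[OF spray_fibre_hom(1) h_t(1), simplified]
    is_fibre_hom_pdy[OF spray_fibre_hom(2) k_t(1), simplified]
  note pdx_N = N(1)[THEN is_fibre_hom_pdx[OF open_base _ Dx(1)]]
    N(2)[THEN is_fibre_hom_pdx[OF open_base _ h_x(2)]]
    N(3)[THEN is_fibre_hom_pdx[OF open_base _ Dx(2)]]
    N(4)[THEN is_fibre_hom_pdx[OF open_base _ k_x(2)]]
  note pdy_N = is_fibre_hom_pdy[OF N(1) Dt(1), simplified]
    is_fibre_hom_pdy[OF N(2) h_t(2), simplified]
    is_fibre_hom_pdy[OF N(3) Dt(2), simplified]
    is_fibre_hom_pdy[OF N(4) k_t(2), simplified]
  note pdx_G = spray_fibre_hom(1)[THEN is_fibre_hom_pdx[OF open_base _ h_x(1)]]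
    spray_fibre_hom(2)[THEN is_fibre_hom_pdx[OF open_base _ k_x(1)]]
  note vals = spray_fibre_hom[THEN is_fibre_homD, OF x y, folded t_def]
    N[THEN is_fibre_homD, OF x y, folded t_def]
    pdx_N[THEN is_fibre_homD, OF x y, folded t_def]
    pdy_N[THEN is_fibre_homD, OF x y, folded t_def]
    pdx_G[THEN is_fibre_homD, OF x y, folded t_def]
  have "riemann_curv F 1 2 x y = 0" "riemann_curv F 1 1 x y = 0"
    using flat_eqs(1)[OF x, of t] unfolding riemann_curv_def sum_2 vals y2
    by (simp; algebra)+
  moreover have "riemann_curv F 2 2 x y = 0" "riemann_curv F 2 1 x y = 0"
    using flat_eqs(2)[OF x, of t] unfolding riemann_curv_def sum_2 vals y2
    by (simp; algebra)+
  ultimately show ?thesis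
    using exhaust_2[of i] exhaust_2[of j] by auto
qed

end

section \<open>The fibre parameter\<close>

definition slope :: "real \<Rightarrow> real \<Rightarrow> real \<Rightarrow> real" where
  "slope a c s = 3 * a / s + c / (2 * s\<^sup>2) - s"

text \<open>
  Up to the factor \<open>- 1 / s\<^sup>3\<close> this is the derivative of the slope in \<open>s\<close>, hence the denominator
  in every implicit derivative of \<open>s\<close>.
\<close>

definition slope_jac :: "real \<Rightarrow> real \<Rightarrow> real \<Rightarrow> real" where
  "slope_jac a c s = s ^ 3 + 3 * a * s + c"

definition slope_inv :: "real \<Rightarrow> real \<Rightarrow> real \<Rightarrow> real" where
  "slope_inv a c t = (THE s. s > 0 \<and> slope a c s = t)"

lemma slope_jac_pos: "\<lbrakk>a > 0; c > 0; s > 0\<rbrakk> \<Longrightarrow> slope_jac a c s > 0"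
  by (simp add: slope_jac_def add_pos_pos)

lemma slope_strict_antimono:
  assumes "a > 0" "c > 0" "0 < s" "s < s'"
  shows "slope a c s' < slope a c s"
proof -
  have "3 * a / s' < 3 * a / s" "c / (2 * s'\<^sup>2) < c / (2 * s\<^sup>2)"
    using assms by (auto intro!: divide_strict_left_mono mult_pos_pos power_strict_mono)
  then show ?thesis using assms by (simp add: slope_def)
qed

text \<open>
  Multiplied by \<open>s\<^sup>2\<close> the equation is a cubic that is negative at \<open>0\<close> and nonnegative at \<open>b\<close>,
  which is chosen so large that \<open>b + t \<ge> 1 + 3 a + c\<close>.
\<close>

lemma slope_surj:
  assumes a: "a > 0" and c: "c > 0"
  shows "\<exists>s>0. slope a c s = t"
proof -
  define p where "p s = s ^ 3 + t * s\<^sup>2 - 3 * a * s - c / 2" for s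
  define b where "b = 1 + \<bar>t\<bar> + 3 * a + c"
  have b: "b \<ge> 1" using a c by (simp add: b_def)
  have "p b = b * (b * (b + t) - 3 * a) - c / 2"
    by (simp add: p_def power2_eq_square power3_eq_cube algebra_simps)
  moreover have "b * (b + t) \<ge> 1 * (1 + 3 * a + c)"
    using b a c by (intro mult_mono) (auto simp: b_def)
  then have "b * (b * (b + t) - 3 * a) \<ge> 1 * (1 + c)"
    using b a c by (intro mult_mono) auto
  ultimately have "p b \<ge> 0" using c by simp
  moreover have "p 0 \<le> 0" using c by (simp add: p_def)
  moreover have "continuous_on {0..b} p" unfolding p_def by (intro continuous_intros)
  ultimately obtain s where s: "0 \<le> s" "p s = 0"
    using IVT'[of p 0 0 b] b by auto
  have "s \<noteq> 0" using s c by (auto simp: p_def)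
  then have "slope a c s = t"
    using s(2) by (simp add: slope_def p_def field_simps power2_eq_square power3_eq_cube)
  then show ?thesis using s \<open>s \<noteq> 0\<close> by (intro exI[of _ s]) auto
qed

lemma slope_inv_eqI:
  assumes "a > 0" "c > 0" "s > 0" "slope a c s = t"
  shows "slope_inv a c t = s"
  unfolding slope_inv_def
proof (rule the_equality)
  show "s' = s" if "s' > 0 \<and> slope a c s' = t" for s'
    using that assms slope_strict_antimono[of a c s s'] slope_strict_antimono[of a c s' s]
    by (cases s s' rule: linorder_cases) auto
qed (use assms in auto)

lemma slope_inv:
  assumes "a > 0" "c > 0"
  shows "slope_inv a c t > 0" "slope a c (slope_inv a c t) = t"
  using slope_surj[OF assms, of t] slope_inv_eqI[OF assms] by auto

text \<open>
  The map \<open>(a, c, t) \<mapsto> (a, c, s)\<close> inverts \<open>(a, c, s) \<mapsto> (a, c, t)\<close>, whose differential is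
  invertible.
\<close>

lemma slope_inv_has_derivative:
  assumes a: "a > 0" and c: "c > 0" and s_def: "s = slope_inv a c t"
  shows "((\<lambda>(a, c, t). slope_inv a c t) has_derivative
    (\<lambda>(u, v, w). (3 * s\<^sup>2 * u + s * v / 2 - s ^ 3 * w) / slope_jac a c s)) (at (a, c, t))"
proof -
  define S :: "(real \<times> real \<times> real) set" where "S = {0<..} \<times> {0<..} \<times> {0<..}"
  define f where "f = (\<lambda>(a, c, s). (a, c, slope a c s))"
  define g where "g = (\<lambda>(a, c, t). (a, c, slope_inv a c t))"
  define f' where "f' = (\<lambda>(u, v, w). (u, v, 3 * u / s + v / (2 * s\<^sup>2) - slope_jac a c s / s ^ 3 * w))"
  define g' where
    "g' = (\<lambda>(u, v, w). (u, v, (3 * s\<^sup>2 * u + s * v / 2 - s ^ 3 * w) / slope_jac a c s))"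
  have s: "s > 0" "slope a c s = t" using slope_inv[OF a c] by (auto simp: s_def)
  have S: "open S" "(a, c, s) \<in> S" using a c s by (auto simp: S_def open_Times)
  have "continuous_on S f"
    unfolding f_def S_def slope_def case_prod_unfold
    by (intro continuous_intros) auto
  moreover have "g (f p) = p" if "p \<in> S" for p
    using that by (auto simp: f_def g_def S_def intro: slope_inv_eqI)
  moreover have "(f has_derivative f') (at (a, c, s))"
    unfolding f_def f'_def slope_def slope_jac_def case_prod_unfold
    using s by (auto intro!: derivative_eq_intros ext simp: field_simps power2_eq_square power3_eq_cube)
  moreover have "f' \<circ> g' = id"
    using s slope_jac_pos[OF a c s(1)]
    by (auto simp: f'_def g'_def fun_eq_iff field_simps power2_eq_square power3_eq_cube)
  ultimately have "(g has_derivative g') (at (f (a, c, s)))"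
    using has_derivative_inverse_strong[OF S] by blast
  then have "(g has_derivative g') (at (a, c, t))" by (simp add: f_def s)
  then have "((\<lambda>p. snd (snd (g p))) has_derivative (\<lambda>p. snd (snd (g' p)))) (at (a, c, t))"
    by (intro has_derivative_snd)
  then show ?thesis by (simp add: g_def g'_def case_prod_unfold)
qed

lemma slope_inv_DERIV:
  assumes a: "A r > 0" and c: "C r > 0" and s_def: "s = slope_inv (A r) (C r) (T r)"
    and d: "(A has_real_derivative \<alpha>) (at r)" "(C has_real_derivative \<gamma>) (at r)"
      "(T has_real_derivative \<tau>) (at r)"
  shows "((\<lambda>r. slope_inv (A r) (C r) (T r)) has_real_derivative
    (3 * s\<^sup>2 * \<alpha> + s * \<gamma> / 2 - s ^ 3 * \<tau>) / slope_jac (A r) (C r) s) (at r)"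
proof -
  have "((\<lambda>r. (A r, C r, T r)) has_derivative (\<lambda>u. (\<alpha> * u, \<gamma> * u, \<tau> * u))) (at r)"
    using d by (intro has_derivative_Pair) (auto simp: has_field_derivative_def)
  from has_derivative_compose[OF this slope_inv_has_derivative[OF a c s_def]]
  show ?thesis
    by (auto simp: has_field_derivative_def field_simps elim!: has_derivative_eq_rhs)
qed

definition lift :: "(real \<Rightarrow> real \<Rightarrow> real \<Rightarrow> real) \<Rightarrow> real^2 \<Rightarrow> real \<Rightarrow> real" where
  "lift \<phi> x t = \<phi> (x$1) (x$2) (slope_inv (x$1) (x$2) t)"

definition quadrant :: "(real^2) set" where
  "quadrant = {x. x$1 > 0 \<and> x$2 > 0}"

text \<open>
  Phrased along curves, so that one statement serves both for differentiation in the slope and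
  for differentiation in the base point at fixed slope, where \<open>s\<close> moves as well.
\<close>

definition has_partials where
  "has_partials \<phi> \<phi>a \<phi>c \<phi>s \<longleftrightarrow> (\<forall>A C S \<alpha> \<gamma> \<sigma>. \<forall>r::real.
     A r > 0 \<and> C r > 0 \<and> S r > 0 \<and> (A has_real_derivative \<alpha>) (at r) \<and>
     (C has_real_derivative \<gamma>) (at r) \<and> (S has_real_derivative \<sigma>) (at r) \<longrightarrow>
     ((\<lambda>r. \<phi> (A r) (C r) (S r)) has_real_derivative
        \<phi>a (A r) (C r) (S r) * \<alpha> + \<phi>c (A r) (C r) (S r) * \<gamma> + \<phi>s (A r) (C r) (S r) * \<sigma>) (at r))"

lemma lift_t_partial:
  assumes "\<And>a c s. \<lbrakk>a > 0; c > 0; s > 0\<rbrakk> \<Longrightarrow>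
    (\<phi> a c has_real_derivative - (slope_jac a c s / s ^ 3) * \<phi>t a c s) (at s)"
  shows "t_partial quadrant (lift \<phi>) (lift \<phi>t)"
  unfolding t_partial_def
proof (intro ballI allI)
  fix x t assume "x \<in> quadrant"
  then have x: "x$1 > 0" "x$2 > 0" by (auto simp: quadrant_def)
  define s where "s = slope_inv (x$1) (x$2) t"
  have s: "s > 0" using slope_inv[OF x] by (simp add: s_def)
  note J = slope_jac_pos[OF x s]
  have "(slope_inv (x$1) (x$2) has_real_derivative (- (s ^ 3) / slope_jac (x$1) (x$2) s)) (at t)"
    using slope_inv_DERIV[of "\<lambda>_. x$1" t "\<lambda>_. x$2" s "\<lambda>t. t" 0 0 1] x
    by (simp add: s_def)
  from DERIV_chain2[OF assms[OF x s, unfolded s_def] this]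
  show "(lift \<phi> x has_real_derivative lift \<phi>t x t) (at t)"
    using s J by (simp add: lift_def[abs_def] s_def[symmetric])
qed

text \<open>
  If \<open>\<phi>t\<close> is the derivative in the slope, then the derivative in \<open>s\<close> is
  \<open>- (slope_jac / s\<^sup>3) \<phi>t\<close>. At fixed slope \<open>s\<close> has the derivatives \<open>3 s\<^sup>2 / slope_jac\<close> in \<open>a\<close> and
  \<open>s / (2 slope_jac)\<close> in \<open>c\<close>, so the denominator cancels from the correction terms.
\<close>

lemma lift_partials:
  assumes "has_partials \<phi> \<phi>a \<phi>c (\<lambda>a c s. - (slope_jac a c s / s ^ 3) * \<phi>t a c s)"
  shows "t_partial quadrant (lift \<phi>) (lift \<phi>t)"
    and "x_partials quadrant (lift \<phi>)
      (\<lambda>k. lift (\<lambda>a c s. if k = 1 then \<phi>a a c s - 3 / s * \<phi>t a c s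
                     else \<phi>c a c s - \<phi>t a c s / (2 * s\<^sup>2)))"
proof -
  show "t_partial quadrant (lift \<phi>) (lift \<phi>t)"
  proof (rule lift_t_partial)
    fix a c s :: real assume "a > 0" "c > 0" "s > 0"
    then show "(\<phi> a c has_real_derivative - (slope_jac a c s / s ^ 3) * \<phi>t a c s) (at s)"
      using assms[unfolded has_partials_def, rule_format, of "\<lambda>_. a" s "\<lambda>_. c" "\<lambda>s. s" 0 0 1]
      by simp
  qed
  show "x_partials quadrant (lift \<phi>)
      (\<lambda>k. lift (\<lambda>a c s. if k = 1 then \<phi>a a c s - 3 / s * \<phi>t a c s
                     else \<phi>c a c s - \<phi>t a c s / (2 * s\<^sup>2)))"
    unfolding x_partials_def
  proof (intro ballI allI)
    fix x t and k :: 2 assume "x \<in> quadrant"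
    then have x: "x$1 > 0" "x$2 > 0" by (auto simp: quadrant_def)
    define s where "s = slope_inv (x$1) (x$2) t"
    have s: "s > 0" using slope_inv[OF x] by (simp add: s_def)
    note J = slope_jac_pos[OF x s]
    let ?A = "\<lambda>r. (x + r *\<^sub>R axis k 1)$1" and ?C = "\<lambda>r. (x + r *\<^sub>R axis k 1)$2"
    let ?\<alpha> = "if k = 1 then 1 else 0 :: real" and ?\<gamma> = "if k = 1 then 0 else 1 :: real"
    have A: "(?A has_real_derivative ?\<alpha>) (at 0)" and C: "(?C has_real_derivative ?\<gamma>) (at 0)"
      using exhaust_2[of k] by (auto simp: axis_def intro!: derivative_eq_intros)
    have S: "((\<lambda>r. slope_inv (?A r) (?C r) t) has_real_derivative
        (3 * s\<^sup>2 * ?\<alpha> + s * ?\<gamma> / 2 - s ^ 3 * 0) / slope_jac (x$1) (x$2) s) (at 0)"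
      using slope_inv_DERIV[of ?A 0 ?C s "\<lambda>_. t" ?\<alpha> ?\<gamma> 0] A C x by (simp add: s_def)
    have "((\<lambda>r. \<phi> (?A r) (?C r) (slope_inv (?A r) (?C r) t)) has_real_derivative
        \<phi>a (x$1) (x$2) s * ?\<alpha> + \<phi>c (x$1) (x$2) s * ?\<gamma>
        + (- (slope_jac (x$1) (x$2) s / s ^ 3) * \<phi>t (x$1) (x$2) s)
          * ((3 * s\<^sup>2 * ?\<alpha> + s * ?\<gamma> / 2 - s ^ 3 * 0) / slope_jac (x$1) (x$2) s)) (at 0)"
      using assms[unfolded has_partials_def, rule_format, of ?A 0 ?C
          "\<lambda>r. slope_inv (?A r) (?C r) t", OF conjI, OF _ conjI, OF _ _ conjI,
          OF _ _ _ conjI, OF _ _ _ _ conjI, OF _ _ _ A C S] x s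
      by (simp add: s_def)
    then show "((\<lambda>r. lift \<phi> (x + r *\<^sub>R axis k 1) t) has_real_derivative
        lift (\<lambda>a c s. if k = 1 then \<phi>a a c s - 3 / s * \<phi>t a c s
                     else \<phi>c a c s - \<phi>t a c s / (2 * s\<^sup>2)) x t) (at 0)"
      unfolding lift_def using s J
      by (cases "k = 1") (simp_all add: s_def[symmetric] power2_eq_square power3_eq_cube mult_ac)
  qed
qed

section \<open>The metric and its spray as functions of the fibre parameter\<close>

definition wt :: "real \<Rightarrow> real \<Rightarrow> real" where
  "wt a s = (s\<^sup>2 + a) powr (- 2 / 3)"

lemma wt_pos: "\<lbrakk>a > 0; s > 0\<rbrakk> \<Longrightarrow> wt a s > 0"
  using add_pos_pos[of "s\<^sup>2" a] by (simp add: wt_def)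

lemma wt_DERIV:
  assumes "A r > 0" "S r > 0"
    and "(A has_real_derivative \<alpha>) (at r)" "(S has_real_derivative \<sigma>) (at r)"
  shows "((\<lambda>r. wt (A r) (S r)) has_real_derivative
    - (2 / 3) * wt (A r) (S r) * (2 * S r * \<sigma> + \<alpha>) / ((S r)\<^sup>2 + A r)) (at r)"
proof -
  have p: "(S r)\<^sup>2 + A r > 0" using assms by (simp add: add_pos_pos)
  have "((\<lambda>r. (S r)\<^sup>2 + A r) has_real_derivative 2 * S r * \<sigma> + \<alpha>) (at r)"
    using assms by (auto intro!: derivative_eq_intros)
  from DERIV_powr[OF this p DERIV_const, of "- 2 / 3"] p
  show ?thesis unfolding wt_def by (elim DERIV_cong) (simp add: field_simps)
qed

text \<open>
  The restriction of \<open>F\<close> to the line \<open>y\<^sub>1 = 1\<close> and its first two derivatives in the slope.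
\<close>

definition slice0 where "slice0 a c s = (slope_jac a c s)\<^sup>2 * wt a s / s\<^sup>2"
definition slice1 where
  "slice1 a c s = (10 * c * s\<^sup>2 + 6 * a * c - 8 * s ^ 5) * wt a s / (3 * (s\<^sup>2 + a))"
definition slice2 where "slice2 a c s = 40 / 9 * s ^ 6 * wt a s / (s\<^sup>2 + a)\<^sup>2"

text \<open>
  The two spray coefficients on the line \<open>y\<^sub>1 = 1\<close> and their first three derivatives in the
  slope. Parallel translation keeps both \<open>F\<close> and \<open>s\<^sup>2 + a\<close> constant, and this determines them.
\<close>

definition hspray0 :: "real \<Rightarrow> real \<Rightarrow> real \<Rightarrow> real" where "hspray0 a c s = 1 / s\<^sup>2"
definition hspray1 where "hspray1 a c s = 2 / slope_jac a c s"
definition hspray2 where "hspray2 a c s = 6 * (s\<^sup>2 + a) * s ^ 3 / (slope_jac a c s) ^ 3"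
definition hspray3 where
  "hspray3 a c s = - 3 * s ^ 5 * (10 * c * s\<^sup>2 + 6 * a * c - 8 * s ^ 5) / (slope_jac a c s) ^ 5"

definition kspray0 :: "real \<Rightarrow> real \<Rightarrow> real \<Rightarrow> real" where
  "kspray0 a c s = (12 * a * s + c - 20 * s ^ 3) / (8 * s ^ 4)"
definition kspray1 where "kspray1 a c s = (9 * a * s + c - 5 * s ^ 3) / (2 * s\<^sup>2 * slope_jac a c s)"
definition kspray2 where
  "kspray2 a c s = (c\<^sup>2 + 9 * a * c * s + 27 * a\<^sup>2 * s\<^sup>2 + 5 * c * s ^ 3 + 18 * a * s ^ 4 - 5 * s ^ 6)
     / (slope_jac a c s) ^ 3"
definition kspray3 where
  "kspray3 a c s = 3 * s ^ 5 * (27 * a ^ 3 + 45 * a\<^sup>2 * s\<^sup>2 + 45 * a * s ^ 4 - 5 * s ^ 6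
     + 20 * c * s ^ 3 - 2 * c\<^sup>2) / (slope_jac a c s) ^ 5"

lemma slope_jac_DERIV:
  assumes "(A has_real_derivative \<alpha>) (at r)" "(C has_real_derivative \<gamma>) (at r)"
    "(S has_real_derivative \<sigma>) (at r)"
  shows "((\<lambda>r. slope_jac (A r) (C r) (S r)) has_real_derivative
    3 * ((S r)\<^sup>2 + A r) * \<sigma> + 3 * S r * \<alpha> + \<gamma>) (at r)"
  using assms unfolding slope_jac_def
  by (auto intro!: derivative_eq_intros simp: algebra_simps power2_eq_square)

lemma hspray0_partials:
  "has_partials hspray0 (\<lambda>a c s. 0) (\<lambda>a c s. 0) (\<lambda>a c s. - (slope_jac a c s / s ^ 3) * hspray1 a c s)"
proof -
  have J: "slope_jac a c s \<noteq> 0" if "a > 0" "c > 0" "s > 0" for a c s using slope_jac_pos[OF that] by simp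
  show ?thesis
    unfolding has_partials_def hspray0_def hspray1_def
    by (auto intro!: derivative_eq_intros simp: J power2_eq_square power3_eq_cube)
qed

lemma hspray1_partials:
  "has_partials hspray1 (\<lambda>a c s. - 6 * s / (slope_jac a c s)\<^sup>2) (\<lambda>a c s. - 2 / (slope_jac a c s)\<^sup>2)
     (\<lambda>a c s. - (slope_jac a c s / s ^ 3) * hspray2 a c s)"
proof -
  have J: "slope_jac a c s \<noteq> 0" if "a > 0" "c > 0" "s > 0" for a c s using slope_jac_pos[OF that] by simp
  show ?thesis
    unfolding has_partials_def hspray1_def hspray2_def
    by (auto intro!: derivative_eq_intros slope_jac_DERIV simp: J)
       (simp add: J divide_simps, algebra)
qed

lemma slope_jac_power_DERIV:
  "((\<lambda>s. (slope_jac a c s) ^ m) has_real_derivative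
     real m * (slope_jac a c s) ^ (m - 1) * (3 * (s\<^sup>2 + a))) (at s)"
proof -
  have "(slope_jac a c has_real_derivative 3 * (s\<^sup>2 + a)) (at s)"
    using slope_jac_DERIV[of "\<lambda>_. a" 0 s "\<lambda>_. c" 0 "\<lambda>s. s" 1] by simp
  from DERIV_power[OF this, of m] show ?thesis by (simp add: mult_ac)
qed

text \<open>
  Eliminating \<open>c\<close> in favour of \<open>J = slope_jac a c s\<close> turns all denominators into monomials. The
  same substitution is used below, together with \<open>a = \<tau> - s\<^sup>2\<close> where \<open>\<tau> = s\<^sup>2 + a\<close> occurs.
\<close>

lemma hspray2_DERIV:
  assumes "a > 0" "c > 0" "s > 0"
  shows "(hspray2 a c has_real_derivative - (slope_jac a c s / s ^ 3) * hspray3 a c s) (at s)"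
proof -
  have nz: "slope_jac a c s \<noteq> 0" "s \<noteq> 0" using slope_jac_pos[OF assms] assms by auto
  have c: "c = slope_jac a c s - 3 * a * s - s ^ 3" by (simp add: slope_jac_def)
  have N: "((\<lambda>s. 6 * (s\<^sup>2 + a) * s ^ 3) has_real_derivative 30 * s ^ 4 + 18 * a * s\<^sup>2) (at s)"
    by (auto intro!: derivative_eq_intros simp: power2_eq_square eval_nat_numeral algebra_simps)
  have D: "(slope_jac a c s) ^ 3 \<noteq> 0" using nz by simp
  show ?thesis
    unfolding hspray2_def hspray3_def
  proof (rule DERIV_cong[OF DERIV_divide[OF N slope_jac_power_DERIV D]])
    obtain J where J: "slope_jac a c s = J" "c = J - 3 * a * s - s ^ 3" using c by blast
    show "((30 * s ^ 4 + 18 * a * s\<^sup>2) * (slope_jac a c s) ^ 3 - 6 * (s\<^sup>2 + a) * s ^ 3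
        * (real 3 * (slope_jac a c s) ^ (3 - 1) * (3 * (s\<^sup>2 + a)))) / ((slope_jac a c s) ^ 3 * (slope_jac a c s) ^ 3)
      = - (slope_jac a c s / s ^ 3)
        * (- 3 * s ^ 5 * (10 * c * s\<^sup>2 + 6 * a * c - 8 * s ^ 5) / (slope_jac a c s) ^ 5)"
      using nz unfolding J(1) unfolding J(2) by (simp add: divide_simps) algebra
  qed
qed

lemma kspray0_partials:
  "has_partials kspray0 (\<lambda>a c s. 3 / (2 * s ^ 3)) (\<lambda>a c s. 1 / (8 * s ^ 4))
     (\<lambda>a c s. - (slope_jac a c s / s ^ 3) * kspray1 a c s)"
  unfolding has_partials_def kspray0_def kspray1_def
proof (intro allI impI, elim conjE)
  fix A C S :: "real \<Rightarrow> real" and \<alpha> \<gamma> \<sigma> r :: real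
  assume pos: "A r > 0" "C r > 0" "S r > 0"
    and [derivative_intros]: "(A has_real_derivative \<alpha>) (at r)"
      "(C has_real_derivative \<gamma>) (at r)" "(S has_real_derivative \<sigma>) (at r)"
  have nz: "slope_jac (A r) (C r) (S r) \<noteq> 0" "S r \<noteq> 0" using slope_jac_pos[OF pos] pos by auto
  have N: "((\<lambda>r. 12 * A r * S r + C r - 20 * S r ^ 3) has_real_derivative
      12 * (\<alpha> * S r + A r * \<sigma>) + \<gamma> - 60 * (S r)\<^sup>2 * \<sigma>) (at r)"
    by (auto intro!: derivative_eq_intros simp: algebra_simps power2_eq_square)
  have D: "((\<lambda>r. 8 * S r ^ 4) has_real_derivative 32 * S r ^ 3 * \<sigma>) (at r)"
    by (auto intro!: derivative_eq_intros)
  show "((\<lambda>r. (12 * A r * S r + C r - 20 * S r ^ 3) / (8 * S r ^ 4)) has_real_derivative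
      3 / (2 * S r ^ 3) * \<alpha> + 1 / (8 * S r ^ 4) * \<gamma>
      + - (slope_jac (A r) (C r) (S r) / S r ^ 3)
        * ((9 * A r * S r + C r - 5 * S r ^ 3) / (2 * (S r)\<^sup>2 * slope_jac (A r) (C r) (S r))) * \<sigma>) (at r)"
    by (rule DERIV_cong[OF DERIV_divide[OF N D]])
       (use nz in \<open>simp_all add: divide_simps\<close>, algebra)
qed

lemma kspray1_partials:
  "has_partials kspray1
     (\<lambda>a c s. 9 / (2 * s * slope_jac a c s) - 3 * (9 * a * s + c - 5 * s ^ 3) / (2 * s * (slope_jac a c s)\<^sup>2))
     (\<lambda>a c s. 1 / (2 * s\<^sup>2 * slope_jac a c s) - (9 * a * s + c - 5 * s ^ 3) / (2 * s\<^sup>2 * (slope_jac a c s)\<^sup>2))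
     (\<lambda>a c s. - (slope_jac a c s / s ^ 3) * kspray2 a c s)"
  unfolding has_partials_def kspray1_def kspray2_def
proof (intro allI impI, elim conjE)
  fix A C S :: "real \<Rightarrow> real" and \<alpha> \<gamma> \<sigma> r :: real
  assume pos: "A r > 0" "C r > 0" "S r > 0"
    and d[derivative_intros]: "(A has_real_derivative \<alpha>) (at r)"
      "(C has_real_derivative \<gamma>) (at r)" "(S has_real_derivative \<sigma>) (at r)"
  define a c s J where "a = A r" and "c = C r" and "s = S r" and "J = slope_jac a c s"
  note val = a_def[symmetric] c_def[symmetric] s_def[symmetric] J_def[symmetric]
  have nz: "J \<noteq> 0" "s \<noteq> 0" using slope_jac_pos[OF pos] pos by (auto simp: val)
  have c: "c = J - 3 * a * s - s ^ 3" by (simp add: J_def slope_jac_def)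
  have N: "((\<lambda>r. 9 * A r * S r + C r - 5 * S r ^ 3) has_real_derivative
      9 * (\<alpha> * s + a * \<sigma>) + \<gamma> - 15 * s\<^sup>2 * \<sigma>) (at r)"
    by (auto intro!: derivative_eq_intros simp: algebra_simps power2_eq_square val)
  have "((\<lambda>r. 2 * (S r)\<^sup>2) has_real_derivative 4 * s * \<sigma>) (at r)"
    by (auto intro!: derivative_eq_intros simp: val)
  note D = DERIV_mult[OF this slope_jac_DERIV[OF d]]
  have D0: "2 * (S r)\<^sup>2 * slope_jac (A r) (C r) (S r) \<noteq> 0" using nz by (simp add: val)
  show "((\<lambda>r. (9 * A r * S r + C r - 5 * S r ^ 3) / (2 * (S r)\<^sup>2 * slope_jac (A r) (C r) (S r)))
    has_real_derivative
      (9 / (2 * S r * slope_jac (A r) (C r) (S r))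
        - 3 * (9 * A r * S r + C r - 5 * S r ^ 3) / (2 * S r * (slope_jac (A r) (C r) (S r))\<^sup>2)) * \<alpha>
      + (1 / (2 * (S r)\<^sup>2 * slope_jac (A r) (C r) (S r))
        - (9 * A r * S r + C r - 5 * S r ^ 3) / (2 * (S r)\<^sup>2 * (slope_jac (A r) (C r) (S r))\<^sup>2)) * \<gamma>
      + - (slope_jac (A r) (C r) (S r) / S r ^ 3)
        * (((C r)\<^sup>2 + 9 * A r * C r * S r + 27 * (A r)\<^sup>2 * (S r)\<^sup>2 + 5 * C r * S r ^ 3
            + 18 * A r * S r ^ 4 - 5 * S r ^ 6) / (slope_jac (A r) (C r) (S r)) ^ 3) * \<sigma>) (at r)"
    apply (rule DERIV_cong[OF DERIV_divide[OF N D D0]])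
    unfolding val unfolding c using nz by (simp add: divide_simps) algebra
qed

lemma kspray2_DERIV:
  assumes "a > 0" "c > 0" "s > 0"
  shows "(kspray2 a c has_real_derivative - (slope_jac a c s / s ^ 3) * kspray3 a c s) (at s)"
proof -
  have nz: "slope_jac a c s \<noteq> 0" "s \<noteq> 0" using slope_jac_pos[OF assms] assms by auto
  have c: "c = slope_jac a c s - 3 * a * s - s ^ 3" by (simp add: slope_jac_def)
  have N: "((\<lambda>s. c\<^sup>2 + 9 * a * c * s + 27 * a\<^sup>2 * s\<^sup>2 + 5 * c * s ^ 3 + 18 * a * s ^ 4 - 5 * s ^ 6)
     has_real_derivative
      9 * a * c + 54 * a\<^sup>2 * s + 15 * c * s\<^sup>2 + 72 * a * s ^ 3 - 30 * s ^ 5) (at s)"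
    by (auto intro!: derivative_eq_intros)
  have D: "(slope_jac a c s) ^ 3 \<noteq> 0" using nz by simp
  show ?thesis
    unfolding kspray2_def kspray3_def
  proof (rule DERIV_cong[OF DERIV_divide[OF N slope_jac_power_DERIV D]])
    obtain J where J: "slope_jac a c s = J" "c = J - 3 * a * s - s ^ 3" using c by blast
    show "((9 * a * c + 54 * a\<^sup>2 * s + 15 * c * s\<^sup>2 + 72 * a * s ^ 3 - 30 * s ^ 5) * (slope_jac a c s) ^ 3
        - (c\<^sup>2 + 9 * a * c * s + 27 * a\<^sup>2 * s\<^sup>2 + 5 * c * s ^ 3 + 18 * a * s ^ 4 - 5 * s ^ 6)
        * (real 3 * (slope_jac a c s) ^ (3 - 1) * (3 * (s\<^sup>2 + a)))) / ((slope_jac a c s) ^ 3 * (slope_jac a c s) ^ 3)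
      = - (slope_jac a c s / s ^ 3)
        * (3 * s ^ 5 * (27 * a ^ 3 + 45 * a\<^sup>2 * s\<^sup>2 + 45 * a * s ^ 4 - 5 * s ^ 6
     + 20 * c * s ^ 3 - 2 * c\<^sup>2) / (slope_jac a c s) ^ 5)"
      using nz unfolding J(1) unfolding J(2) by (simp add: divide_simps) algebra
  qed
qed

lemma slice0_partials:
  "has_partials slice0
     (\<lambda>a c s. 6 * slope_jac a c s * wt a s / s - 2 / 3 * (slope_jac a c s)\<^sup>2 * wt a s / (s\<^sup>2 * (s\<^sup>2 + a)))
     (\<lambda>a c s. 2 * slope_jac a c s * wt a s / s\<^sup>2)
     (\<lambda>a c s. - (slope_jac a c s / s ^ 3) * slice1 a c s)"
  unfolding has_partials_def slice0_def slice1_def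
proof (intro allI impI, elim conjE)
  fix A C S :: "real \<Rightarrow> real" and \<alpha> \<gamma> \<sigma> r :: real
  assume pos: "A r > 0" "C r > 0" "S r > 0"
    and d[derivative_intros]: "(A has_real_derivative \<alpha>) (at r)"
      "(C has_real_derivative \<gamma>) (at r)" "(S has_real_derivative \<sigma>) (at r)"
  define a c s J w \<tau> where "a = A r" and "c = C r" and "s = S r" and "J = slope_jac a c s" and "w = wt a s"
    and "\<tau> = s\<^sup>2 + a"
  note val = a_def[symmetric] c_def[symmetric] s_def[symmetric] J_def[symmetric] w_def[symmetric]
    \<tau>_def[symmetric]
  have nz: "J \<noteq> 0" "s \<noteq> 0" "\<tau> \<noteq> 0"
    using slope_jac_pos[OF pos] pos add_pos_pos[of "s\<^sup>2" a] by (auto simp: val)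
  have c: "c = J - 3 * a * s - s ^ 3" and a: "a = \<tau> - s\<^sup>2" by (simp_all add: J_def slope_jac_def \<tau>_def)
  note N = DERIV_mult[OF DERIV_power[OF slope_jac_DERIV[OF d], of 2] wt_DERIV[OF pos(1,3) d(1,3)]]
  have D: "((\<lambda>r. (S r)\<^sup>2) has_real_derivative 2 * s * \<sigma>) (at r)"
    by (auto intro!: derivative_eq_intros simp: val)
  have D0: "(S r)\<^sup>2 \<noteq> 0" using nz by (simp add: val)
  show "((\<lambda>r. (slope_jac (A r) (C r) (S r))\<^sup>2 * wt (A r) (S r) / (S r)\<^sup>2) has_real_derivative
      (6 * slope_jac (A r) (C r) (S r) * wt (A r) (S r) / S r
        - 2 / 3 * (slope_jac (A r) (C r) (S r))\<^sup>2 * wt (A r) (S r) / ((S r)\<^sup>2 * ((S r)\<^sup>2 + A r))) * \<alpha>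
      + 2 * slope_jac (A r) (C r) (S r) * wt (A r) (S r) / (S r)\<^sup>2 * \<gamma>
      + - (slope_jac (A r) (C r) (S r) / S r ^ 3)
        * ((10 * C r * (S r)\<^sup>2 + 6 * A r * C r - 8 * S r ^ 5) * wt (A r) (S r)
            / (3 * ((S r)\<^sup>2 + A r))) * \<sigma>) (at r)"
    apply (rule DERIV_cong[OF DERIV_divide[OF N D D0]])
    unfolding val unfolding c unfolding a using nz by (simp add: divide_simps) algebra
qed

lemma slice1_partials:
  "has_partials slice1
     (\<lambda>a c s. 2 * c * wt a s / (s\<^sup>2 + a)
        - 5 / 9 * (10 * c * s\<^sup>2 + 6 * a * c - 8 * s ^ 5) * wt a s / (s\<^sup>2 + a)\<^sup>2)
     (\<lambda>a c s. (10 * s\<^sup>2 + 6 * a) * wt a s / (3 * (s\<^sup>2 + a)))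
     (\<lambda>a c s. - (slope_jac a c s / s ^ 3) * slice2 a c s)"
  unfolding has_partials_def slice1_def slice2_def
proof (intro allI impI, elim conjE)
  fix A C S :: "real \<Rightarrow> real" and \<alpha> \<gamma> \<sigma> r :: real
  assume pos: "A r > 0" "C r > 0" "S r > 0"
    and d[derivative_intros]: "(A has_real_derivative \<alpha>) (at r)"
      "(C has_real_derivative \<gamma>) (at r)" "(S has_real_derivative \<sigma>) (at r)"
  define a c s J w \<tau> where "a = A r" and "c = C r" and "s = S r" and "J = slope_jac a c s" and "w = wt a s"
    and "\<tau> = s\<^sup>2 + a"
  note val = a_def[symmetric] c_def[symmetric] s_def[symmetric] J_def[symmetric] w_def[symmetric]
    \<tau>_def[symmetric]
  have nz: "J \<noteq> 0" "s \<noteq> 0" "\<tau> \<noteq> 0"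
    using slope_jac_pos[OF pos] pos add_pos_pos[of "s\<^sup>2" a] by (auto simp: val)
  have c: "c = J - 3 * a * s - s ^ 3" and a: "a = \<tau> - s\<^sup>2" by (simp_all add: J_def slope_jac_def \<tau>_def)
  have "((\<lambda>r. 10 * C r * (S r)\<^sup>2 + 6 * A r * C r - 8 * S r ^ 5) has_real_derivative
      10 * (\<gamma> * s\<^sup>2 + 2 * c * s * \<sigma>) + 6 * (\<alpha> * c + a * \<gamma>) - 40 * s ^ 4 * \<sigma>) (at r)"
    by (auto intro!: derivative_eq_intros simp: val algebra_simps)
  note N = DERIV_mult[OF this wt_DERIV[OF pos(1,3) d(1,3)]]
  have D: "((\<lambda>r. 3 * ((S r)\<^sup>2 + A r)) has_real_derivative 3 * (2 * s * \<sigma> + \<alpha>)) (at r)"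
    by (auto intro!: derivative_eq_intros simp: val)
  have D0: "3 * ((S r)\<^sup>2 + A r) \<noteq> 0" using nz by (simp add: val)
  show "((\<lambda>r. (10 * C r * (S r)\<^sup>2 + 6 * A r * C r - 8 * S r ^ 5) * wt (A r) (S r)
        / (3 * ((S r)\<^sup>2 + A r))) has_real_derivative
      (2 * C r * wt (A r) (S r) / ((S r)\<^sup>2 + A r)
        - 5 / 9 * (10 * C r * (S r)\<^sup>2 + 6 * A r * C r - 8 * S r ^ 5) * wt (A r) (S r)
          / ((S r)\<^sup>2 + A r)\<^sup>2) * \<alpha>
      + (10 * (S r)\<^sup>2 + 6 * A r) * wt (A r) (S r) / (3 * ((S r)\<^sup>2 + A r)) * \<gamma>
      + - (slope_jac (A r) (C r) (S r) / S r ^ 3)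
        * (40 / 9 * S r ^ 6 * wt (A r) (S r) / ((S r)\<^sup>2 + A r)\<^sup>2) * \<sigma>) (at r)"
    apply (rule DERIV_cong[OF DERIV_divide[OF N D D0]])
    unfolding val unfolding c unfolding a using nz by (simp add: divide_simps) algebra
qed

section \<open>The equations for geodesics, Landsberg curvature and flag curvature\<close>

text \<open>
  The value on \<open>y\<^sub>1 \<le> 0\<close> is a norm whose unit ball has straight sides there, which makes every
  direction of that half-plane singular.
\<close>

definition surface_metric :: tfun where
  "surface_metric x y =
     (if y$1 > 0 then y$1 * slice0 (x$1) (x$2) (slope_inv (x$1) (x$2) (y$2 / y$1))
      else \<bar>y$2\<bar> - y$1)"

lemma open_quadrant: "open quadrant"
  unfolding quadrant_def
  by (intro open_Collect_conj open_Collect_less continuous_intros)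

text \<open>
  The brackets on the left are the base-point derivatives at fixed slope of \<open>slice0\<close> and
  \<open>slice1\<close> in the form in which \<open>lift_partials\<close> delivers them.
\<close>

lemma slice_geodesic_eqs:
  assumes "a > 0" "c > 0" "s > 0" and t: "t = slope a c s"
  defines "J \<equiv> slope_jac a c s" and "w \<equiv> wt a s"
  shows
    "(6 * J * w / s - 2 / 3 * J\<^sup>2 * w / (s\<^sup>2 * (s\<^sup>2 + a)) - 3 / s * slice1 a c s)
       + t * (2 * J * w / s\<^sup>2 - slice1 a c s / (2 * s\<^sup>2))
     = 2 * ((slice0 a c s - t * slice1 a c s) * hspray0 a c s + slice1 a c s * kspray0 a c s)"
    "(2 * c * w / (s\<^sup>2 + a) - 5 / 9 * (10 * c * s\<^sup>2 + 6 * a * c - 8 * s ^ 5) * w / (s\<^sup>2 + a)\<^sup>2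
        - 3 / s * slice2 a c s)
       + t * ((10 * s\<^sup>2 + 6 * a) * w / (3 * (s\<^sup>2 + a)) - slice2 a c s / (2 * s\<^sup>2))
       - (2 * J * w / s\<^sup>2 - slice1 a c s / (2 * s\<^sup>2))
     = 2 * slice2 a c s * (kspray0 a c s - t * hspray0 a c s)"
proof -
  define \<tau> where "\<tau> = s\<^sup>2 + a"
  have nz: "J \<noteq> 0" "s \<noteq> 0" "\<tau> \<noteq> 0"
    using slope_jac_pos[OF assms(1-3)] assms(1-3) add_pos_pos[of "s\<^sup>2" a] by (auto simp: J_def \<tau>_def)
  have c: "c = J - 3 * a * s - s ^ 3" and a: "a = \<tau> - s\<^sup>2" by (simp_all add: J_def slope_jac_def \<tau>_def)
  note defs = t slope_def slice0_def slice1_def slice2_def hspray0_def kspray0_def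
  show "(6 * J * w / s - 2 / 3 * J\<^sup>2 * w / (s\<^sup>2 * (s\<^sup>2 + a)) - 3 / s * slice1 a c s)
       + t * (2 * J * w / s\<^sup>2 - slice1 a c s / (2 * s\<^sup>2))
     = 2 * ((slice0 a c s - t * slice1 a c s) * hspray0 a c s + slice1 a c s * kspray0 a c s)"
    unfolding defs J_def[symmetric] w_def[symmetric] \<tau>_def[symmetric] 
    unfolding c unfolding a using nz by (simp add: divide_simps) algebra
  show "(2 * c * w / (s\<^sup>2 + a) - 5 / 9 * (10 * c * s\<^sup>2 + 6 * a * c - 8 * s ^ 5) * w / (s\<^sup>2 + a)\<^sup>2
        - 3 / s * slice2 a c s)
       + t * ((10 * s\<^sup>2 + 6 * a) * w / (3 * (s\<^sup>2 + a)) - slice2 a c s / (2 * s\<^sup>2))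
       - (2 * J * w / s\<^sup>2 - slice1 a c s / (2 * s\<^sup>2))
     = 2 * slice2 a c s * (kspray0 a c s - t * hspray0 a c s)"
    unfolding defs J_def[symmetric] w_def[symmetric] \<tau>_def[symmetric] 
    unfolding c unfolding a using nz by (simp add: divide_simps) algebra
qed

text \<open>
  Both terms are products of the same two polynomials: \<open>hspray3\<close> is a multiple of \<open>slice1\<close>, and
  \<open>kspray3\<close> is the opposite multiple of \<open>slice0 - t slice1\<close>.
\<close>

lemma slice_landsberg_eq:
  assumes "a > 0" "c > 0" "s > 0" and t: "t = slope a c s"
  shows "(slice0 a c s - t * slice1 a c s) * hspray3 a c s + slice1 a c s * kspray3 a c s = 0"
proof -
  define \<tau> J w where "\<tau> = s\<^sup>2 + a" and "J = slope_jac a c s" and "w = wt a s"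
  have nz: "J \<noteq> 0" "s \<noteq> 0" "\<tau> \<noteq> 0"
    using slope_jac_pos[OF assms(1-3)] assms(1-3) add_pos_pos[of "s\<^sup>2" a] by (auto simp: J_def \<tau>_def)
  have c: "c = J - 3 * a * s - s ^ 3" and a: "a = \<tau> - s\<^sup>2" by (simp_all add: J_def slope_jac_def \<tau>_def)
  show ?thesis
    unfolding t slope_def slice0_def slice1_def hspray3_def kspray3_def
      J_def[symmetric] w_def[symmetric] \<tau>_def[symmetric] 
    unfolding c unfolding a using nz by (simp add: divide_simps) algebra
qed

text \<open>
  In terms of \<open>J\<close>, \<open>\<tau>\<close> and \<open>s\<close> the slope and the spray coefficients are short sums of monomials,
  which keeps the common denominators of the two equations small.
\<close>

lemma spray_flat_eqs:
  assumes "a > 0" "c > 0" "s > 0" and t: "t = slope a c s"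
  defines "J \<equiv> slope_jac a c s"
  shows
    "2 * (0 - hspray1 a c s / (2 * s\<^sup>2))
       - (- 6 * s / J\<^sup>2 - 3 / s * hspray2 a c s)
       - t * (- 2 / J\<^sup>2 - hspray2 a c s / (2 * s\<^sup>2))
       + 2 * (kspray0 a c s - t * hspray0 a c s) * hspray2 a c s + t * (hspray1 a c s)\<^sup>2 - hspray1 a c s * kspray1 a c s = 0"
    "2 * (1 / (8 * s ^ 4) - kspray1 a c s / (2 * s\<^sup>2))
       - (9 / (2 * s * J) - 3 * (9 * a * s + c - 5 * s ^ 3) / (2 * s * J\<^sup>2) - 3 / s * kspray2 a c s)
       - t * (1 / (2 * s\<^sup>2 * J) - (9 * a * s + c - 5 * s ^ 3) / (2 * s\<^sup>2 * J\<^sup>2)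
           - kspray2 a c s / (2 * s\<^sup>2))
       + 2 * (hspray0 a c s * (kspray1 a c s - t * kspray2 a c s) + kspray0 a c s * kspray2 a c s)
       - ((2 * kspray0 a c s - t * kspray1 a c s) * hspray1 a c s + (kspray1 a c s)\<^sup>2) = 0"
proof -
  define \<tau> where "\<tau> = s\<^sup>2 + a"
  have nz: "J \<noteq> 0" "s \<noteq> 0"
    using slope_jac_pos[OF assms(1-3)] assms(1-3) by (auto simp: J_def)
  have c: "c = J - 3 * a * s - s ^ 3" and a: "a = \<tau> - s\<^sup>2" by (simp_all add: J_def slope_jac_def \<tau>_def)
  have t': "t = J / (2 * s\<^sup>2) + 3 * \<tau> / (2 * s) - 3 * s"
    unfolding t slope_def c a using nz by (simp add: divide_simps) algebra
  have K0: "kspray0 a c s = J / (8 * s ^ 4) + 9 * \<tau> / (8 * s ^ 3) - 15 / (4 * s)"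
    unfolding kspray0_def c a using nz by (simp add: divide_simps) algebra
  have q: "9 * a * s + c - 5 * s ^ 3 = J + 6 * \<tau> * s - 12 * s ^ 3"
    unfolding c a by algebra
  have K1: "kspray1 a c s = 1 / (2 * s\<^sup>2) + (3 * \<tau> - 6 * s\<^sup>2) / (s * J)"
    unfolding kspray1_def J_def[symmetric] q using nz by (simp add: divide_simps) algebra
  have p: "c\<^sup>2 + 9 * a * c * s + 27 * a\<^sup>2 * s\<^sup>2 + 5 * c * s ^ 3 + 18 * a * s ^ 4 - 5 * s ^ 6
      = J\<^sup>2 + 3 * \<tau> * s * J + 9 * s\<^sup>2 * \<tau> * (\<tau> - 2 * s\<^sup>2)"
    unfolding c a by algebra
  have K2: "kspray2 a c s = 1 / J + 3 * \<tau> * s / J\<^sup>2 + 9 * s\<^sup>2 * \<tau> * (\<tau> - 2 * s\<^sup>2) / J ^ 3"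
    unfolding kspray2_def J_def[symmetric] p using nz by (simp add: divide_simps) algebra
  have h: "hspray0 a c s = 1 / s\<^sup>2" "hspray1 a c s = 2 / J" "hspray2 a c s = 6 * \<tau> * s ^ 3 / J ^ 3"
    by (simp_all add: hspray0_def hspray1_def hspray2_def J_def \<tau>_def)
  have kth: "kspray0 a c s - t * hspray0 a c s = - 3 * J / (8 * s ^ 4) - 3 * \<tau> / (8 * s ^ 3) - 3 / (4 * s)"
    unfolding t' K0 h using nz by (simp add: field_simps eval_nat_numeral)
  show "2 * (0 - hspray1 a c s / (2 * s\<^sup>2))
       - (- 6 * s / J\<^sup>2 - 3 / s * hspray2 a c s)
       - t * (- 2 / J\<^sup>2 - hspray2 a c s / (2 * s\<^sup>2))
       + 2 * (kspray0 a c s - t * hspray0 a c s) * hspray2 a c s + t * (hspray1 a c s)\<^sup>2 - hspray1 a c s * kspray1 a c s = 0"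
    unfolding kth unfolding t' h K1 using nz by (simp add: field_simps eval_nat_numeral)
  show "2 * (1 / (8 * s ^ 4) - kspray1 a c s / (2 * s\<^sup>2))
       - (9 / (2 * s * J) - 3 * (9 * a * s + c - 5 * s ^ 3) / (2 * s * J\<^sup>2) - 3 / s * kspray2 a c s)
       - t * (1 / (2 * s\<^sup>2 * J) - (9 * a * s + c - 5 * s ^ 3) / (2 * s\<^sup>2 * J\<^sup>2)
           - kspray2 a c s / (2 * s\<^sup>2))
       + 2 * (hspray0 a c s * (kspray1 a c s - t * kspray2 a c s) + kspray0 a c s * kspray2 a c s)
       - ((2 * kspray0 a c s - t * kspray1 a c s) * hspray1 a c s + (kspray1 a c s)\<^sup>2) = 0"
    unfolding t' K0 K1 K2 h q using nz by (simp add: field_simps eval_nat_numeral)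
qed

lemma slice0_pos: "\<lbrakk>a > 0; c > 0; s > 0\<rbrakk> \<Longrightarrow> slice0 a c s > 0"
  using slope_jac_pos[of a c s] wt_pos[of a s] by (simp add: slice0_def)

lemma slice2_pos: "\<lbrakk>a > 0; c > 0; s > 0\<rbrakk> \<Longrightarrow> slice2 a c s > 0"
  using wt_pos[of a s] add_pos_pos[of "s\<^sup>2" a] by (simp add: slice2_def)

interpretation surface: half_plane_surface quadrant surface_metric
  "lift slice0" "lift slice1" "lift slice2" "lift hspray0" "lift hspray1" "lift hspray2" "lift hspray3"
  "lift kspray0" "lift kspray1" "lift kspray2" "lift kspray3"
  "\<lambda>k. lift (\<lambda>a c s. if k = 1
     then (6 * slope_jac a c s * wt a s / s - 2 / 3 * (slope_jac a c s)\<^sup>2 * wt a s / (s\<^sup>2 * (s\<^sup>2 + a))) - 3 / s * slice1 a c s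
     else 2 * slope_jac a c s * wt a s / s\<^sup>2 - slice1 a c s / (2 * s\<^sup>2))"
  "\<lambda>k. lift (\<lambda>a c s. if k = 1
     then (2 * c * wt a s / (s\<^sup>2 + a)
        - 5 / 9 * (10 * c * s\<^sup>2 + 6 * a * c - 8 * s ^ 5) * wt a s / (s\<^sup>2 + a)\<^sup>2) - 3 / s * slice2 a c s
     else (10 * s\<^sup>2 + 6 * a) * wt a s / (3 * (s\<^sup>2 + a)) - slice2 a c s / (2 * s\<^sup>2))"
  "\<lambda>k. lift (\<lambda>a c s. if k = 1 then 0 - 3 / s * hspray1 a c s else 0 - hspray1 a c s / (2 * s\<^sup>2))"
  "\<lambda>k. lift (\<lambda>a c s. if k = 1 then - 6 * s / (slope_jac a c s)\<^sup>2 - 3 / s * hspray2 a c s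
     else - 2 / (slope_jac a c s)\<^sup>2 - hspray2 a c s / (2 * s\<^sup>2))"
  "\<lambda>k. lift (\<lambda>a c s. if k = 1 then 3 / (2 * s ^ 3) - 3 / s * kspray1 a c s
     else 1 / (8 * s ^ 4) - kspray1 a c s / (2 * s\<^sup>2))"
  "\<lambda>k. lift (\<lambda>a c s. if k = 1
     then (9 / (2 * s * slope_jac a c s) - 3 * (9 * a * s + c - 5 * s ^ 3) / (2 * s * (slope_jac a c s)\<^sup>2))
        - 3 / s * kspray2 a c s
     else (1 / (2 * s\<^sup>2 * slope_jac a c s) - (9 * a * s + c - 5 * s ^ 3) / (2 * s\<^sup>2 * (slope_jac a c s)\<^sup>2))
        - kspray2 a c s / (2 * s\<^sup>2))"
proof
  show "open quadrant" by (rule open_quadrant)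
  show "is_fibre_hom quadrant surface_metric 1 (lift slice0)"
    by (simp add: is_fibre_hom_def surface_metric_def lift_def)
  note lift_partials[OF slice0_partials] lift_partials[OF slice1_partials] lift_partials[OF hspray0_partials]
    lift_partials[OF hspray1_partials] lift_partials[OF kspray0_partials] lift_partials[OF kspray1_partials]
    lift_t_partial[OF hspray2_DERIV] lift_t_partial[OF kspray2_DERIV]
  then show "t_partial quadrant (lift slice0) (lift slice1)" "t_partial quadrant (lift slice1) (lift slice2)"
    "t_partial quadrant (lift hspray0) (lift hspray1)" "t_partial quadrant (lift hspray1) (lift hspray2)"
    "t_partial quadrant (lift hspray2) (lift hspray3)" "t_partial quadrant (lift kspray0) (lift kspray1)"
    "t_partial quadrant (lift kspray1) (lift kspray2)" "t_partial quadrant (lift kspray2) (lift kspray3)"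
    by blast+
qed (rule lift_partials[OF slice0_partials] lift_partials[OF slice1_partials] lift_partials[OF hspray0_partials]
    lift_partials[OF hspray1_partials] lift_partials[OF kspray0_partials] lift_partials[OF kspray1_partials]
  | simp add: lift_def quadrant_def slope_inv slice0_pos slice2_pos
      slice_geodesic_eqs[simplified] slice_landsberg_eq spray_flat_eqs[simplified]; fail)+

section \<open>Smoothness\<close>

definition right_cone :: "((real^2) \<times> (real^2)) set" where
  "right_cone = quadrant \<times> {y. y$1 > 0}"

lemma open_right_cone: "open right_cone"
  unfolding right_cone_def
  by (intro open_Times open_quadrant open_Collect_less continuous_intros)

lemma Ck_on_cong:
  assumes "open S" "\<And>p. p \<in> S \<Longrightarrow> f p = g p" "Ck_on n S f"
  shows "Ck_on n S g"
  using assms(2,3)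
proof (induction n arbitrary: f g)
  case 0
  then show ?case using continuous_on_cong[of S S f g] by simp
next
  case (Suc n)
  have f: "f differentiable (at p)" if "p \<in> S" for p using Suc.prems that by auto
  have "g differentiable (at p)" if "p \<in> S" for p
    using f[OF that] Suc.prems(1) assms(1) that has_derivative_transform_within_open
    unfolding differentiable_def by metis
  moreover have "frechet_derivative f (at p) = frechet_derivative g (at p)" if "p \<in> S" for p
    using frechet_derivative_transform_within_open[OF f[OF that] assms(1) that] Suc.prems(1) by blast
  then have "Ck_on n S (\<lambda>p. frechet_derivative g (at p) v)" for v
    using Suc.IH[of "\<lambda>p. frechet_derivative f (at p) v" "\<lambda>p. frechet_derivative g (at p) v"]
      Suc.prems(2) by auto
  ultimately show ?case by auto
qed

text \<open>
  A class of functions that contains the metric and is closed under directional derivatives. Only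
  the fibre parameter is not elementary, and its derivatives are rational in itself.
\<close>

inductive tame :: "((real^2) \<times> (real^2) \<Rightarrow> real) \<Rightarrow> bool" where
  tame_const: "tame (\<lambda>p. r)"
| tame_linear: "bounded_linear f \<Longrightarrow> tame f"
| tame_add: "\<lbrakk>tame f; tame g\<rbrakk> \<Longrightarrow> tame (\<lambda>p. f p + g p)"
| tame_mult: "\<lbrakk>tame f; tame g\<rbrakk> \<Longrightarrow> tame (\<lambda>p. f p * g p)"
| tame_inverse: "\<lbrakk>tame f; \<And>p. p \<in> right_cone \<Longrightarrow> f p \<noteq> 0\<rbrakk> \<Longrightarrow> tame (\<lambda>p. inverse (f p))"
| tame_powr: "\<lbrakk>tame f; \<And>p. p \<in> right_cone \<Longrightarrow> f p > 0\<rbrakk> \<Longrightarrow> tame (\<lambda>p. f p powr r)"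
| tame_slope_inv: "tame (\<lambda>p. slope_inv (fst p $ 1) (fst p $ 2) (snd p $ 2 / snd p $ 1))"

lemma tame_diff: "\<lbrakk>tame f; tame g\<rbrakk> \<Longrightarrow> tame (\<lambda>p. f p - g p)"
  using tame_add[of f "\<lambda>p. - 1 * g p"] tame_mult[OF tame_const, of g "-1"] by simp

lemma tame_divide:
  "\<lbrakk>tame f; tame g; \<And>p. p \<in> right_cone \<Longrightarrow> g p \<noteq> 0\<rbrakk> \<Longrightarrow> tame (\<lambda>p. f p / g p)"
  unfolding divide_inverse by (intro tame_mult tame_inverse)

lemma tame_power: "tame f \<Longrightarrow> tame (\<lambda>p. f p ^ m)"
  by (induction m) (auto intro: tame_const tame_mult)

lemma bounded_linear_coord:
  "bounded_linear (\<lambda>p :: (real^2) \<times> (real^2). fst p $ i)"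
  "bounded_linear (\<lambda>p :: (real^2) \<times> (real^2). snd p $ i)"
  by (intro bounded_linear_compose[OF bounded_linear_vec_nth] bounded_linear_fst bounded_linear_snd)+

lemmas tame_coord = bounded_linear_coord[THEN tame_linear]

lemmas tame_intros = tame_const tame_coord tame_add tame_mult tame_diff tame_power tame_divide
  tame_slope_inv

lemma tame_slope_jac:
  "tame (\<lambda>p. slope_jac (fst p $ 1) (fst p $ 2)
     (slope_inv (fst p $ 1) (fst p $ 2) (snd p $ 2 / snd p $ 1)))"
  unfolding slope_jac_def by (intro tame_intros)

lemma right_coneD:
  assumes "p \<in> right_cone"
  shows "fst p $ 1 > 0" "fst p $ 2 > 0" "snd p $ 1 > 0"
  using assms by (auto simp: right_cone_def quadrant_def)

lemma tame_derivative:
  assumes "tame f"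
  shows "\<exists>f'. (\<forall>p\<in>right_cone. (f has_derivative f' p) (at p)) \<and> (\<forall>v. tame (\<lambda>p. f' p v))"
  using assms
proof induction
  case (tame_const r)
  show ?case
    by (rule exI[of _ "\<lambda>_ _. 0"]) (auto intro: tame.tame_const)
next
  case (tame_linear f)
  then show ?case
    by (intro exI[of _ "\<lambda>_. f"]) (auto intro: tame.tame_const bounded_linear_imp_has_derivative)
next
  case (tame_add f g)
  then obtain f' g' where "\<forall>p\<in>right_cone. (f has_derivative f' p) (at p)" "\<forall>v. tame (\<lambda>p. f' p v)"
    "\<forall>p\<in>right_cone. (g has_derivative g' p) (at p)" "\<forall>v. tame (\<lambda>p. g' p v)" by blast
  then show ?case
    by (intro exI[of _ "\<lambda>p v. f' p v + g' p v"]) (auto intro: has_derivative_add tame.tame_add)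
next
  case (tame_mult f g)
  then obtain f' g' where "\<forall>p\<in>right_cone. (f has_derivative f' p) (at p)" "\<forall>v. tame (\<lambda>p. f' p v)"
    "\<forall>p\<in>right_cone. (g has_derivative g' p) (at p)" "\<forall>v. tame (\<lambda>p. g' p v)" by blast
  moreover from this have "tame (\<lambda>p. f p * g' p v + f' p v * g p)" for v
    using tame_mult.hyps by (intro tame.tame_add tame.tame_mult) blast+
  ultimately show ?case
    by (intro exI[of _ "\<lambda>p v. f p * g' p v + f' p v * g p"]) (auto intro: has_derivative_mult)
next
  case (tame_inverse f)
  then obtain f' where f': "\<forall>p\<in>right_cone. (f has_derivative f' p) (at p)" "\<forall>v. tame (\<lambda>p. f' p v)"
    by blast
  have "tame (\<lambda>p. - 1 * (inverse (f p) * f' p v * inverse (f p)))" for v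
    using tame_inverse.hyps f'(2) by (intro tame.tame_mult tame.tame_inverse tame.tame_const) blast+
  moreover have "((\<lambda>p. inverse (f p)) has_derivative
      (\<lambda>v. - 1 * (inverse (f p) * f' p v * inverse (f p)))) (at p)" if "p \<in> right_cone" for p
    using Deriv.has_derivative_inverse[of f p "f' p" UNIV] f'(1) tame_inverse.hyps(2) that by simp
  ultimately show ?case
    by (intro exI[of _ "\<lambda>p v. - 1 * (inverse (f p) * f' p v * inverse (f p))"]) blast
next
  case (tame_powr f r)
  then obtain f' where f': "\<forall>p\<in>right_cone. (f has_derivative f' p) (at p)" "\<forall>v. tame (\<lambda>p. f' p v)"
    by blast
  have "tame (\<lambda>p. f p powr r * (f' p v * r / f p))" for v
    using tame_powr.hyps f'(2)
    by (intro tame_intros tame.tame_powr) (blast | metis less_irrefl)+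
  moreover have "((\<lambda>p. f p powr r) has_derivative (\<lambda>v. f p powr r * (f' p v * r / f p))) (at p)"
    if "p \<in> right_cone" for p
    using has_derivative_powr[of f "f' p" p UNIV "\<lambda>_. r" "\<lambda>_. 0"] f' tame_powr that by auto
  ultimately show ?case
    by (intro exI[of _ "\<lambda>p v. f p powr r * (f' p v * r / f p)"]) auto
next
  case tame_slope_inv
  define s where "s p = slope_inv (fst p $ 1) (fst p $ 2) (snd p $ 2 / snd p $ 1)"
    for p :: "(real^2) \<times> (real^2)"
  define s' where "s' p v = (3 * (s p)\<^sup>2 * fst v $ 1 + s p * fst v $ 2 / 2
      - s p ^ 3 * ((snd v $ 2 * snd p $ 1 - snd p $ 2 * snd v $ 1) / (snd p $ 1)\<^sup>2))
      / slope_jac (fst p $ 1) (fst p $ 2) (s p)" for p v :: "(real^2) \<times> (real^2)"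
  have nz: "snd p $ 1 \<noteq> 0"
    "slope_jac (fst p $ 1) (fst p $ 2) (slope_inv (fst p $ 1) (fst p $ 2) (snd p $ 2 / snd p $ 1)) \<noteq> 0"
    if "p \<in> right_cone" for p
    using right_coneD[OF that] slope_jac_pos slope_inv by (metis less_irrefl)+
  have "(s has_derivative s' p) (at p)" if p: "p \<in> right_cone" for p
  proof -
    note pos = right_coneD[OF p]
    have "((\<lambda>p. (fst p $ 1, fst p $ 2, snd p $ 2 / snd p $ 1)) has_derivative
        (\<lambda>v. (fst v $ 1, fst v $ 2,
           (snd v $ 2 * snd p $ 1 - snd p $ 2 * snd v $ 1) / (snd p $ 1)\<^sup>2))) (at p)"
      using pos
      by (auto intro!: derivative_eq_intros bounded_linear_coord[THEN bounded_linear_imp_has_derivative]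
          simp: power2_eq_square)
    from has_derivative_compose[OF this slope_inv_has_derivative[OF pos(1,2) refl]]
    show ?thesis by (simp add: s_def[abs_def] s'_def[abs_def])
  qed
  moreover have "tame (\<lambda>p. s' p v)" for v
    unfolding s'_def s_def
    by (intro tame_intros tame_slope_jac) (simp_all add: nz)
  ultimately show ?case unfolding s_def[symmetric] by blast
qed

text \<open>
  A class of differentiable functions closed under directional derivatives consists of smooth
  functions.
\<close>

lemma tame_imp_Ck_on: "tame f \<Longrightarrow> Ck_on n right_cone f"
proof (induction n arbitrary: f)
  case 0
  then show ?case
    using tame_derivative has_derivative_continuous continuous_at_imp_continuous_on
    by (metis Ck_on.simps(1))
next
  case (Suc n)
  obtain f' where f': "\<And>p. p \<in> right_cone \<Longrightarrow> (f has_derivative f' p) (at p)"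
    "\<And>v. tame (\<lambda>p. f' p v)"
    using tame_derivative[OF Suc.prems] by blast
  have "Ck_on n right_cone (\<lambda>p. frechet_derivative f (at p) v)" for v
    using Ck_on_cong[OF open_right_cone _ Suc.IH[OF f'(2)[of v]]] frechet_derivative_at[OF f'(1)]
    by metis
  then show ?case using f'(1) differentiableI by fastforce
qed

lemma smooth_surface_metric: "smooth_on right_cone (\<lambda>(x, y). surface_metric x y)"
proof -
  define s where "s p = slope_inv (fst p $ 1) (fst p $ 2) (snd p $ 2 / snd p $ 1)"
    for p :: "(real^2) \<times> (real^2)"
  have s: "s p > 0" if "p \<in> right_cone" for p
    using right_coneD[OF that] by (simp add: s_def slope_inv)
  have pos: "(s p)\<^sup>2 + fst p $ 1 > 0" "(s p)\<^sup>2 \<noteq> 0" if "p \<in> right_cone" for p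
    using s[OF that] right_coneD[OF that] add_pos_pos[of "(s p)\<^sup>2" "fst p $ 1"] by auto
  have "tame (\<lambda>p. snd p $ 1 * ((slope_jac (fst p $ 1) (fst p $ 2) (s p))\<^sup>2
      * ((s p)\<^sup>2 + fst p $ 1) powr (- 2 / 3) / (s p)\<^sup>2))"
    unfolding s_def
    by (intro tame_intros tame_slope_jac tame_powr pos[unfolded s_def])
  then show ?thesis
    unfolding smooth_on_def
    by (intro allI Ck_on_cong[OF open_right_cone _ tame_imp_Ck_on])
       (auto simp: surface_metric_def slice0_def wt_def s_def right_cone_def)
qed

section \<open>Singular directions and the surface\<close>

lemma pdy_eqI:
  assumes "open W" "y \<in> W" "\<And>y. y \<in> W \<Longrightarrow> f x y = g y"
    and g: "((\<lambda>r. g (y + r *\<^sub>R axis k 1)) has_real_derivative d) (at 0)"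
  shows "pdy k f x y = d"
proof -
  have "open ((\<lambda>r::real. y + r *\<^sub>R axis k 1) -` W)"
    by (intro open_vimage assms(1) continuous_intros)
  from has_field_derivative_transform_within_open[OF g this, of "\<lambda>r. f x (y + r *\<^sub>R axis k 1)"]
  show ?thesis
    unfolding pdy_def using assms(2,3) by (intro DERIV_imp_deriv) auto
qed

text \<open>
  Near \<open>y\<close> the metric is the linear form \<open>\<sigma> y\<^sub>2 - y\<^sub>1\<close>, so its Hessian has rank one and the kernel
  contains \<open>(1, \<sigma>)\<close>.
\<close>

lemma not_pos_def_left_half_plane:
  assumes "y$1 < 0" "y$2 \<noteq> 0"
  shows "\<not> pos_def (fund_tensor surface_metric x y)"
proof -
  define \<sigma> where "\<sigma> = sgn (y$2)"
  have \<sigma>: "\<sigma> * \<sigma> = 1" using assms(2) by (auto simp: \<sigma>_def sgn_if)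
  define W :: "(real^2) set" where "W = {y. y$1 < 0 \<and> \<sigma> * y$2 > 0}"
  have W: "open W" "y \<in> W"
    using assms unfolding W_def
    by (auto intro!: open_Collect_conj open_Collect_less continuous_intros simp: \<sigma>_def sgn_if)
  have sq: "sq surface_metric x z = (\<sigma> * z$2 - z$1)\<^sup>2" if "z \<in> W" for z
  proof -
    have "\<bar>z$2\<bar> = \<sigma> * z$2"
      using that \<sigma> assms(2) by (auto simp: W_def \<sigma>_def sgn_if split: if_splits)
    then show ?thesis using that by (simp add: sq_def surface_metric_def W_def)
  qed
  have d1: "pdy 1 (sq surface_metric) x z = 2 * (z$1 - \<sigma> * z$2)" if "z \<in> W" for z
    by (rule pdy_eqI[OF W(1) that, where g = "\<lambda>z. (\<sigma> * z$2 - z$1)\<^sup>2"])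
      (auto intro!: derivative_eq_intros simp: sq axis_def)
  have d2: "pdy 2 (sq surface_metric) x z = 2 * (z$2 - \<sigma> * z$1)" if "z \<in> W" for z
    by (rule pdy_eqI[OF W(1) that, where g = "\<lambda>z. (\<sigma> * z$2 - z$1)\<^sup>2"])
       (use \<sigma> in \<open>auto intro!: derivative_eq_intros simp: sq axis_def algebra_simps\<close>)
  have "pdy 1 (pdy 1 (sq surface_metric)) x y = 2" "pdy 2 (pdy 1 (sq surface_metric)) x y = - 2 * \<sigma>"
    by (rule pdy_eqI[OF W, where g = "\<lambda>z. 2 * (z$1 - \<sigma> * z$2)"], erule d1,
        auto intro!: derivative_eq_intros simp: axis_def)+
  moreover have
    "pdy 1 (pdy 2 (sq surface_metric)) x y = - 2 * \<sigma>" "pdy 2 (pdy 2 (sq surface_metric)) x y = 2"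
    by (rule pdy_eqI[OF W, where g = "\<lambda>z. 2 * (z$2 - \<sigma> * z$1)"], erule d2,
        auto intro!: derivative_eq_intros simp: axis_def)+
  ultimately have "(vector [1, \<sigma>] :: real^2) \<bullet> (fund_tensor surface_metric x y *v vector [1, \<sigma>]) = 0"
    using \<sigma> by (simp add: fund_tensor_def inner_vec_def matrix_vector_mult_def sum_2)
  moreover have "(vector [1, \<sigma>] :: real^2) \<noteq> 0" by (simp add: vec_eq_iff forall_2)
  ultimately show ?thesis unfolding pos_def_def by (metis less_irrefl)
qed

text \<open>
  The regular cone is open, so a point of it with \<open>y\<^sub>1 \<le> 0\<close> could be moved to one with \<open>y\<^sub>1 < 0\<close>
  and \<open>y\<^sub>2 \<noteq> 0\<close>, where the fundamental tensor is degenerate.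
\<close>

lemma regular_cone_surface_metric: "regular_cone quadrant surface_metric = right_cone"
proof
  have "strongly_convex_on right_cone surface_metric"
    using smooth_surface_metric surface.pos_def_fund_tensor
    by (auto simp: strongly_convex_on_def right_cone_def)
  moreover have "fibre_conic right_cone" "right_cone \<subseteq> slit_bundle quadrant"
    by (auto simp: fibre_conic_def right_cone_def slit_bundle_def)
  ultimately show "right_cone \<subseteq> regular_cone quadrant surface_metric"
    by (intro regular_cone_largest(5) open_right_cone)
  show "regular_cone quadrant surface_metric \<subseteq> right_cone"
  proof (intro subrelI)
    fix x y assume xy: "(x, y) \<in> regular_cone quadrant surface_metric"
    then have x: "x \<in> quadrant" using regular_cone_largest(3) by (fastforce simp: slit_bundle_def)
    have "y$1 > 0"
    proof (rule ccontr)
      assume y: "\<not> y$1 > 0"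
      define v :: "real^2" where "v = vector [-1, if y$2 \<ge> 0 then 1 else -1]"
      have "open ((\<lambda>e. (x, y + e *\<^sub>R v)) -` regular_cone quadrant surface_metric)"
        by (intro open_vimage regular_cone_largest(1) continuous_intros)
      moreover have "(0::real) \<in> (\<lambda>e. (x, y + e *\<^sub>R v)) -` regular_cone quadrant surface_metric"
        using xy by simp
      ultimately obtain e :: real where e: "e > 0" "(x, y + e *\<^sub>R v) \<in> regular_cone quadrant surface_metric"
      proof (elim openE)
        fix d :: real
        assume d: "d > 0" "ball 0 d \<subseteq> (\<lambda>e. (x, y + e *\<^sub>R v)) -` regular_cone quadrant surface_metric"
        have "d / 2 \<in> (\<lambda>e. (x, y + e *\<^sub>R v)) -` regular_cone quadrant surface_metric"
          using d by (intro subsetD[OF d(2)]) simp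
        with d(1) show thesis by (intro that[of "d / 2"]) simp_all
      qed
      then have "pos_def (fund_tensor surface_metric x (y + e *\<^sub>R v))"
        using regular_cone_largest(4) by (fastforce simp: strongly_convex_on_def)
      moreover have "(y + e *\<^sub>R v)$1 < 0" "(y + e *\<^sub>R v)$2 \<noteq> 0"
        using y e(1) by (auto simp: v_def)
      ultimately show False using not_pos_def_left_half_plane by blast
    qed
    with x show "(x, y) \<in> right_cone" by (simp add: right_cone_def)
  qed
qed

lemma singular_finsler_surface_metric: "singular_finsler_surface quadrant surface_metric"
  unfolding singular_finsler_surface_def
proof (intro conjI ballI allI impI)
  show "open quadrant" by (rule open_quadrant)
  have "convex quadrant"
  proof (rule convexI)
    fix x y :: "real^2" and u v :: real
    assume "x \<in> quadrant" "y \<in> quadrant" "u \<ge> 0" "v \<ge> 0" "u + v = 1"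
    then show "u *\<^sub>R x + v *\<^sub>R y \<in> quadrant"
      by (cases "u = 0") (auto simp: quadrant_def intro!: add_pos_nonneg)
  qed
  then show "connected quadrant" by (rule convex_connected)
  have one: "vector [1, 1] \<in> quadrant" by (simp add: quadrant_def)
  then show "quadrant \<noteq> {}" by blast
  show "surface_metric x y > 0" if "x \<in> quadrant" "y \<noteq> 0" for x y
    using that by (auto simp: surface_metric_def quadrant_def slice0_pos slope_inv vec_eq_iff forall_2)
  show "surface_metric x (r *\<^sub>R y) = r * surface_metric x y" if "r > 0" for x y r
    using that by (auto simp: surface_metric_def abs_mult right_diff_distrib zero_less_mult_iff)
  have "(vector [1, 1], vector [1, 0]) \<in> right_cone" using one by (simp add: right_cone_def)
  then show "regular_cone quadrant surface_metric \<noteq> {}"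
    unfolding regular_cone_surface_metric by blast
  show "\<not> strongly_convex_on (slit_bundle quadrant) surface_metric"
  proof
    assume "strongly_convex_on (slit_bundle quadrant) surface_metric"
    moreover have "open (slit_bundle quadrant)" "fibre_conic (slit_bundle quadrant)"
      by (auto simp: slit_bundle_def fibre_conic_def intro!: open_Times open_quadrant)
    ultimately have "slit_bundle quadrant \<subseteq> right_cone"
      using regular_cone_largest(5) regular_cone_surface_metric by blast
    moreover have "(vector [1, 1], vector [-1, 0]) \<in> slit_bundle quadrant"
      using one by (simp add: slit_bundle_def vec_eq_iff forall_2)
    ultimately have "(vector [1, 1], vector [-1, 0]) \<in> right_cone" by blast
    then show False by (simp add: right_cone_def)
  qed
qed

text \<open>
  At \<open>a = c = 1\<close> the slope \<open>5/2\<close> belongs to \<open>s = 1\<close>, and there \<open>hspray3\<close> is \<open>- 24 / 3125\<close>.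
\<close>

lemma not_berwaldian_surface_metric: "\<not> berwaldian quadrant surface_metric"
proof
  let ?x = "vector [1, 1] :: real^2" and ?y = "vector [1, 5/2] :: real^2"
  assume "berwaldian quadrant surface_metric"
  moreover have x: "?x \<in> quadrant" and y: "?y$1 > 0" by (simp_all add: quadrant_def)
  ultimately have "berwald_curv surface_metric 1 2 2 2 ?x ?y = 0"
    unfolding berwaldian_def regular_cone_surface_metric right_cone_def by blast
  moreover have "slope_inv 1 1 (5/2) = 1"
    by (rule slope_inv_eqI) (simp_all add: slope_def)
  ultimately show False
    by (simp add: surface.berwald_curv_eq[OF x y] lift_def hspray3_def slope_jac_def)
qed

theorem corollary3p5:
  "\<exists>(\<Omega> :: (real^2) set) (F :: real^2 \<Rightarrow> real^2 \<Rightarrow> real).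
     singular_finsler_surface \<Omega> F \<and>
     \<not> berwaldian \<Omega> F \<and>
     (\<forall>(x, y)\<in>regular_cone \<Omega> F. \<forall>i. mean_landsberg_curv F i x y = 0) \<and>
     has_flag_curvature \<Omega> F (\<lambda>x y. 0)"
proof (intro exI conjI)
  show "singular_finsler_surface quadrant surface_metric"
    by (rule singular_finsler_surface_metric)
  show "\<not> berwaldian quadrant surface_metric" by (rule not_berwaldian_surface_metric)
  show "\<forall>(x, y)\<in>regular_cone quadrant surface_metric. \<forall>i. mean_landsberg_curv surface_metric i x y = 0"
    using surface.mean_landsberg_curv_zero
    by (auto simp: regular_cone_surface_metric right_cone_def)
  show "has_flag_curvature quadrant surface_metric (\<lambda>x y. 0)"
    using surface.riemann_curv_zero
    by (auto simp: has_flag_curvature_def regular_cone_surface_metric right_cone_def)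
qed

end
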